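(* Let $Z_{12},Z_{34}$ be real with $|Z_{12}|,|Z_{34}|<2m$, let $\theta_{12},\theta_{34}\in(-\pi/4,\pi/4)$ with $\sin2\theta_{12}=Z_{12}/(2m)$, $\sin2\theta_{34}=Z_{34}/(2m)$, let $\kappa\in\mathbb C$, and consider the $\mathcal N=4$ supergravity superamplitudes $$\mathcal M_{+2}=\frac{\kappa}{2m^2}\,x^2\,S^{(1)}_{12}S^{(1)}_{34},\qquad \mathcal M_{0}=\frac{\kappa}{2m^2}\,S^{(2)}_{12}S^{(2)}_{34}.$$ Then all components of the massive scalar multiplets couple to the graviton only minimally: every component amplitude with massive states of spins $s_1,s_2$ and a helicity $+2$ graviton (from $\mathcal M_{+2}$) vanishes unless $s_1=s_2=s$, in which case it is a constant multiple (independent of the little-group indices) of $x^2\langle\mathbf{12}\rangle^{2s}$; and every component amplitude with massive states of spins $s_1,s_2$ and a helicity $-2$ graviton (from $\mathcal M_0$) vanishes unless $s_1=s_2=s$, in which case it is a constant multiple of $x^{-2}[\mathbf{12}]^{2s}$.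
   Context: Conventions. All two-valued indices are moved with $\epsilon^{12}=-\epsilon^{21}=1$, $\epsilon_{12}=-\epsilon_{21}=-1$. Repeated indices are summed. For undotted spinors $\lambda_\alpha,\mu_\alpha\in\mathbb C^2$: $\lambda^\alpha=\epsilon^{\alpha\beta}\lambda_\beta$, $\langle\lambda\mu\rangle=\lambda^\alpha\mu_\alpha$. For dotted spinors: $\tilde\mu^{\dot\alpha}=\epsilon^{\dot\alpha\dot\beta}\tilde\mu_{\dot\beta}$, $[\lambda\mu]=\tilde\lambda_{\dot\alpha}\tilde\mu^{\dot\alpha}$. Kinematics (fixed). $m>0$. For $i=1,2$ there are spinors $\lambda^I_{i\alpha},\tilde\lambda^I_{i\dot\alpha}$, $I=1,2$ (written $\mathbf i^I$ inside brackets) with $\langle \mathbf i^I\mathbf i^J\rangle=-m\epsilon^{IJ}$, $[\mathbf i^I\mathbf i^J]=m\epsilon^{IJ}$; $p_{i\alpha\dot\alpha}=\lambda^I_{i\alpha}\epsilon_{IJ}\tilde\lambda^J_{i\dot\alpha}$. There are nonzero spinors $\lambda_{P\alpha},\tilde\lambda_{P\dot\alpha}$ (written $P$ in brackets), $P_{\alpha\dot\alpha}=\lambda_{P\alpha}\tilde\lambda_{P\dot\alpha}$, and $p_1+p_2+P=0$. The nonzero number $x$ is defined by $x\lambda_{P\alpha}=\frac1m p_{1\alpha\dot\alpha}\tilde\lambda_P^{\dot\alpha}$. Grassmann algebra: complex, on generators $\eta^A_{iI}$ ($i,I\in\{1,2\}$, $A\in\{1,2,3,4\}$) and $\eta^A_P$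 ($A\in\{1,2,3,4\}$). Put $\sigma_1=1,\sigma_2=-1$, fix reference spinors with $\langle\zeta P\rangle\ne0$, $[\xi P]\ne0$, and set $$\delta^A=\sum_i\langle P\mathbf i^I\rangle\eta^A_{iI},\quad \mathcal H^A=\frac{1}{\langle\zeta P\rangle}\sum_i\langle\zeta\mathbf i^I\rangle\eta^A_{iI},\quad \bar{\mathcal H}^A=\frac1{[\xi P]}\sum_i[\xi\mathbf i^I]\sigma_i\eta^A_{iI}.$$ For $(a,b)=(1,2)$ or $(3,4)$ put $\bar{\mathcal H}_a=-\bar{\mathcal H}^b$, $\bar{\mathcal H}_b=\bar{\mathcal H}^a$, $c=\cos\theta_{ab}$, $s=\sin\theta_{ab}$, and $$S^{(1)}_{ab}=\big(c\,\eta_P^a\delta^a-\delta^a\mathcal H^a-cs\,\delta^a\bar{\mathcal H}_b\eta_P^a\eta_P^b+s\,\delta^a\mathcal H^a\bar{\mathcal H}_b\eta_P^b\big)\big(c\,\eta_P^b\delta^b-\delta^b\mathcal H^b+cs\,\delta^b\bar{\mathcal H}_a\eta_P^a\eta_P^b+s\,\delta^b\mathcal H^b\bar{\mathcal H}_a\eta_P^a\big),$$ $$S^{(2)}_{ab}=-x\big(c\,\delta^a\mathcal H^a\bar{\mathcal H}_a+\delta^a\eta_P^a\bar{\mathcal H}_a+s\,\delta^a\big)\big(c\,\delta^b\mathcal H^b\bar{\mathcal H}_b+\delta^b\eta_P^b\bar{\mathcal H}_b+s\,\delta^b\big).$$ Components. The helicity $+2$ graviton is the $\eta_P$-independent part of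 $\mathcal M_{+2}$; the helicity $-2$ graviton is the coefficient of $\eta_P^1\eta_P^2\eta_P^3\eta_P^4$ in $\mathcal M_0$. For massive leg $i$, the exterior algebra on the $\eta^A_{iI}$ is decomposed under the little group $SU(2)$ acting on the index $I$ into irreducible representations; a massive state of spin $s_i$ is a copy of the spin-$s_i$ representation in it, and the component amplitude is the corresponding coefficient, a tensor symmetric in $2s_1$ upper indices $I_1,\dots,I_{2s_1}$ of leg 1 and symmetric in $2s_2$ upper indices $J_1,\dots,J_{2s_2}$ of leg 2. $\langle\mathbf{12}\rangle^{2s}$ denotes $\prod_{k=1}^{2s}\langle\mathbf1^{I_k}\mathbf2^{J_k}\rangle$ symmetrized in the $I$'s and in the $J$'s, and similarly $[\mathbf{12}]^{2s}$. *)

theory Defs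
  imports "HOL-Analysis.Analysis"
begin

section \<open>Grassmann algebras\<close>

text \<open>The complex Grassmann algebra on a finite, linearly ordered set of generators. An element is
  given by its coefficients with respect to the ordered monomials: \<open>gcoeff f S\<close> is the coefficient
  of the product of the generators in \<open>S\<close>, taken in increasing order (see \<open>eta_monomial\<close> below).\<close>

typedef 'g grassmann = "UNIV :: ('g set \<Rightarrow> complex) set"
  morphisms gcoeff Grass by simp

lemma gcoeff_Grass [simp]: "gcoeff (Grass f) = f"
  by (simp add: Grass_inverse)

lemma grassmann_eqI: "(\<And>S. gcoeff f S = gcoeff g S) \<Longrightarrow> f = g"
  by (metis ext gcoeff_inject)

definition inversions :: "'g::linorder set \<Rightarrow> 'g set \<Rightarrow> nat" where
  "inversions S T = card {(s, t). s \<in> S \<and> t \<in> T \<and> t < s}"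

definition gsign :: "'g::linorder set \<Rightarrow> 'g set \<Rightarrow> complex" where
  "gsign S T = (-1) ^ inversions S T"

lemma inversions_Un1:
  fixes S S' T :: "'g::{finite,linorder} set"
  assumes "S \<inter> S' = {}"
  shows "inversions (S \<union> S') T = inversions S T + inversions S' T"
proof -
  have "{(s, t). s \<in> S \<union> S' \<and> t \<in> T \<and> t < s} =
        {(s, t). s \<in> S \<and> t \<in> T \<and> t < s} \<union> {(s, t). s \<in> S' \<and> t \<in> T \<and> t < s}" by auto
  then show ?thesis unfolding inversions_def
    using assms by (subst card_Un_disjoint[symmetric]) auto
qed

lemma inversions_Un2:
  fixes S T T' :: "'g::{finite,linorder} set"
  assumes "T \<inter> T' = {}"
  shows "inversions S (T \<union> T') = inversions S T + inversions S T'"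
proof -
  have "{(s, t). s \<in> S \<and> t \<in> T \<union> T' \<and> t < s} =
        {(s, t). s \<in> S \<and> t \<in> T \<and> t < s} \<union> {(s, t). s \<in> S \<and> t \<in> T' \<and> t < s}" by auto
  then show ?thesis unfolding inversions_def
    using assms by (subst card_Un_disjoint[symmetric]) auto
qed

lemma gsign_empty [simp]: "gsign {} T = 1" "gsign S {} = 1"
  by (auto simp: gsign_def inversions_def)

instantiation grassmann :: ("{finite,linorder}") ring_1
begin

definition "0 = Grass (\<lambda>S. 0)"
definition "1 = Grass (\<lambda>S. if S = {} then 1 else 0)"
definition "f + g = Grass (\<lambda>S. gcoeff f S + gcoeff g S)"
definition "- f = Grass (\<lambda>S. - gcoeff f S)"
definition "f - g = Grass (\<lambda>S. gcoeff f S - gcoeff g S)"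
definition "f * g = Grass (\<lambda>S. \<Sum>T\<in>Pow S. gsign T (S - T) * gcoeff f T * gcoeff g (S - T))"

lemmas grassmann_defs = zero_grassmann_def one_grassmann_def plus_grassmann_def
  uminus_grassmann_def minus_grassmann_def times_grassmann_def

instance
proof
  fix f g h :: "'a grassmann"
  show "f + g + h = f + (g + h)" "f + g = g + f" "0 + f = f" "- f + f = 0" "f - g = f + - g"
    by (simp_all add: grassmann_defs gcoeff_inverse add_ac)
  show "(f + g) * h = f * h + g * h" "f * (g + h) = f * g + f * h"
    by (simp_all add: grassmann_defs algebra_simps sum.distrib)
  show "(0 :: 'a grassmann) \<noteq> 1"
    by (simp add: grassmann_defs Grass_inject fun_eq_iff)
  show "1 * f = f"
  proof (rule grassmann_eqI)
    fix S :: "'a set"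
    have "gcoeff (1 * f) S = (\<Sum>T\<in>Pow S. if T = {} then gcoeff f S else 0)"
      unfolding times_grassmann_def one_grassmann_def gcoeff_Grass by (rule sum.cong) auto
    then show "gcoeff (1 * f) S = gcoeff f S" by simp
  qed
  show "f * 1 = f"
  proof (rule grassmann_eqI)
    fix S :: "'a set"
    have "gcoeff (f * 1) S = (\<Sum>T\<in>Pow S. if T = S then gcoeff f S else 0)"
      unfolding times_grassmann_def one_grassmann_def gcoeff_Grass by (rule sum.cong) auto
    then show "gcoeff (f * 1) S = gcoeff f S" by simp
  qed
  show "f * g * h = f * (g * h)"
  proof (rule grassmann_eqI)
    fix S :: "'a set"
    have "gcoeff (f * g * h) S = (\<Sum>(T, U)\<in>Sigma (Pow S) Pow.
        gsign T (S - T) * (gsign U (T - U) * gcoeff f U * gcoeff g (T - U)) * gcoeff h (S - T))"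
      by (simp add: times_grassmann_def sum_distrib_left sum_distrib_right sum.Sigma)
    also have "\<dots> = (\<Sum>(U, V)\<in>Sigma (Pow S) (\<lambda>U. Pow (S - U)).
        gsign U (S - U) * gcoeff f U * (gsign V (S - U - V) * gcoeff g V * gcoeff h (S - U - V)))"
    proof (rule sum.reindex_bij_witness[where i = "\<lambda>(U, V). (U \<union> V, U)" and j = "\<lambda>(T, U). (U, T - U)"],
        goal_cases)
      case (5 a)
      obtain T U where a: "a = (T, U)" by (cases a)
      define V where "V = T - U"
      define R where "R = S - T"
      from 5 a have *: "T = U \<union> V" "U \<inter> V = {}" "S - U = V \<union> R" "V \<inter> R = {}" "S - U - V = R"
        by (auto simp: V_def R_def)
      have "gsign T R * gsign U V = gsign U (S - U) * gsign V R"
        using * by (simp add: gsign_def inversions_Un1 inversions_Un2 power_add)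
      then have "gsign T R * (gsign U V * gcoeff f U * gcoeff g V) * gcoeff h R =
          gsign U (S - U) * gcoeff f U * (gsign V R * gcoeff g V * gcoeff h R)"
        by (simp add: mult_ac)
      then show ?case using *(5) unfolding a by (simp only: V_def R_def split)
    qed auto
    also have "\<dots> = gcoeff (f * (g * h)) S"
      by (simp add: times_grassmann_def sum_distrib_left sum_distrib_right sum.Sigma)
    finally show "gcoeff (f * g * h) S = gcoeff (f * (g * h)) S" .
  qed
qed

end

definition gscale :: "complex \<Rightarrow> 'g grassmann \<Rightarrow> 'g grassmann" (infixr "*\<^sub>G" 75) where
  "z *\<^sub>G f = Grass (\<lambda>S. z * gcoeff f S)"

definition eta :: "'g \<Rightarrow> 'g grassmann" where
  "eta g = Grass (\<lambda>S. if S = {g} then 1 else 0)"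

lemma gcoeff_eta_mult:
  fixes f :: "'g::{finite,linorder} grassmann"
  shows "gcoeff (eta g * f) S = (if g \<in> S then gsign {g} (S - {g}) * gcoeff f (S - {g}) else 0)"
proof -
  have "gcoeff (eta g * f) S =
      (\<Sum>T\<in>Pow S. if T = {g} then gsign {g} (S - {g}) * gcoeff f (S - {g}) else 0)"
    unfolding times_grassmann_def eta_def gcoeff_Grass by (rule sum.cong) auto
  then show ?thesis by (simp add: sum.delta)
qed

lemma eta_anticommute:
  fixes g h :: "'g::{finite,linorder}"
  shows "eta g * eta h = - (eta h * eta g)"
proof (rule grassmann_eqI)
  fix S :: "'g set"
  have sgn: "gsign {g} {h} = (if h < g then -1 else 1)" for g h :: 'g
  proof -
    have "{(s, t). s \<in> {g} \<and> t \<in> {h} \<and> t < s} = (if h < g then {(g, h)} else {})" by auto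
    then show ?thesis unfolding gsign_def inversions_def by simp
  qed
  have "gcoeff (eta a * eta b) S = (if a \<noteq> b \<and> S = {a, b} then gsign {a} {b} else 0)" for a b
  proof (cases "a \<in> S \<and> S - {a} = {b}")
    case True
    then have "a \<noteq> b" "S = {a, b}" by blast+
    then show ?thesis by (simp add: gcoeff_eta_mult) (simp add: eta_def)
  next
    case False
    then have "\<not> (a \<noteq> b \<and> S = {a, b})" by auto
    moreover have "gcoeff (eta a * eta b) S = 0"
      using False unfolding gcoeff_eta_mult by (auto simp: eta_def)
    ultimately show ?thesis by argo
  qed
  note c = this[of g h] this[of h g]
  show "gcoeff (eta g * eta h) S = gcoeff (- (eta h * eta g)) S"
    unfolding uminus_grassmann_def gcoeff_Grass c sgn
    by (cases g h rule: linorder_cases) (auto simp: insert_commute)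
qed

lemma eta_monomial:
  fixes S :: "'g::{finite,linorder} set"
  shows "prod_list (map eta (sorted_list_of_set S)) = Grass (\<lambda>T. if T = S then 1 else 0)"
proof -
  have "sorted_wrt (<) xs \<Longrightarrow> prod_list (map eta xs) = Grass (\<lambda>T. if T = set xs then 1 else 0)"
    for xs :: "'g list"
  proof (induction xs)
    case (Cons x xs)
    have [simp]: "x \<notin> set xs" using Cons.prems by auto
    have "inversions {x} (set xs) = 0" using Cons.prems unfolding inversions_def
      by (auto dest: less_asym)
    then have s: "gsign {x} (set xs) = 1" by (simp add: gsign_def)
    have "T - {x} = set xs \<and> x \<in> T \<longleftrightarrow> T = insert x (set xs)" for T
      using \<open>x \<notin> set xs\<close> by blast
    then show ?case using Cons s
      by (intro grassmann_eqI) (auto simp: gcoeff_eta_mult)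
  qed (simp add: one_grassmann_def)
  then show ?thesis by (metis finite set_sorted_list_of_set strict_sorted_list_of_set)
qed

text \<open>The algebra homomorphism that replaces each generator \<open>g\<close> by \<open>h g\<close>
  (where \<open>h g\<close> is a linear combination of generators).\<close>

definition gsubst :: "('g::{finite,linorder} \<Rightarrow> 'g grassmann) \<Rightarrow> 'g grassmann \<Rightarrow> 'g grassmann" where
  "gsubst h f = (\<Sum>S\<in>UNIV. gcoeff f S *\<^sub>G prod_list (map h (sorted_list_of_set S)))"


section \<open>The on-shell generators\<close>

text \<open>\<open>Eta i I A\<close> is the generator of massive leg \<open>i\<close> with little group index \<open>I\<close> and flavour \<open>A\<close>;
  \<open>EtaP A\<close> is that of the graviton multiplet. The numeral types \<open>2\<close> and \<open>4\<close> have the elements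
  \<open>1, 2\<close> and \<open>1, 2, 3, 4\<close> (with \<open>2 = 0\<close> and \<open>4 = 0\<close> there, whence the explicit numbering).\<close>

datatype gen = Eta 2 2 4 | EtaP 4

definition num2 :: "2 \<Rightarrow> nat" where
  "num2 i = (if i = 1 then 0 else 1)"

definition num4 :: "4 \<Rightarrow> nat" where
  "num4 A = (if A = 1 then 0 else if A = 2 then 1 else if A = 3 then 2 else 3)"

fun gen_rank :: "gen \<Rightarrow> nat" where
  "gen_rank (Eta i I A) = 8 * num2 i + 4 * num2 I + num4 A"
| "gen_rank (EtaP A) = 16 + num4 A"

lemma exhaust_4: "A = 1 \<or> A = 2 \<or> A = 3 \<or> A = (4::4)"
proof (induct A)
  case (of_int z)
  then have "z = 0 \<or> z = 1 \<or> z = 2 \<or> z = 3" by auto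
  then show ?case by auto
qed

lemma num2_inject: "num2 i = num2 j \<longleftrightarrow> i = j"
  using exhaust_2[of i] exhaust_2[of j] by (auto simp: num2_def)

lemma num4_inject: "num4 A = num4 B \<longleftrightarrow> A = B"
  using exhaust_4[of A] exhaust_4[of B] by (auto simp: num4_def)

lemma num_less: "num2 i < 2" "num4 A < 4"
  by (auto simp: num2_def num4_def)

lemma rank_digits:
  fixes a a' b b' c c' :: nat
  assumes eq: "8 * a + 4 * b + c = 8 * a' + 4 * b' + c'"
    and bd: "b < 2" "b' < 2" "c < 4" "c' < 4"
  shows "a = a' \<and> b = b' \<and> c = c'"
proof -
  have "\<not> a < a'" "\<not> a' < a" using eq bd by linarith+
  then have a: "a = a'" by simp
  have "\<not> b < b'" "\<not> b' < b" using eq bd unfolding a by linarith+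
  then show ?thesis using a eq by simp
qed

lemma inj_gen_rank: "inj gen_rank"
proof (rule injI)
  fix g h assume "gen_rank g = gen_rank h"
  then show "g = h"
  proof (cases g; cases h)
    fix i I A j J B
    assume gh: "g = Eta i I A" "h = Eta j J B"
    have "num2 i = num2 j \<and> num2 I = num2 J \<and> num4 A = num4 B"
      by (rule rank_digits) (use \<open>gen_rank g = gen_rank h\<close> gh num_less in simp_all)
    then show ?thesis using gh by (simp add: num2_inject num4_inject)
  next
    fix i I A B
    assume "g = Eta i I A" "h = EtaP B"
    with \<open>gen_rank g = gen_rank h\<close> num_less(1)[of i] num_less(1)[of I] num_less(2)[of A]
    show ?thesis by simp
  next
    fix i I A B
    assume "g = EtaP B" "h = Eta i I A"
    with \<open>gen_rank g = gen_rank h\<close> num_less(1)[of i] num_less(1)[of I] num_less(2)[of A]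
    show ?thesis by simp
  qed (use \<open>gen_rank g = gen_rank h\<close> in \<open>simp add: num4_inject\<close>)
qed

instantiation gen :: linorder
begin

definition "g \<le> h \<longleftrightarrow> gen_rank g \<le> gen_rank h"
definition "g < h \<longleftrightarrow> gen_rank g < gen_rank h"

instance
  by standard (auto simp: less_eq_gen_def less_gen_def dest: injD[OF inj_gen_rank])

end

instance gen :: finite
proof
  have "gen_rank g \<le> 19" for g
  proof (cases g)
    case (Eta i I A)
    then show ?thesis using num_less(1)[of i] num_less(1)[of I] num_less(2)[of A] by simp
  next
    case (EtaP A)
    then show ?thesis using num_less(2)[of A] by simp
  qed
  then have "range gen_rank \<subseteq> {..19}" by auto
  then show "finite (UNIV :: gen set)"
    using inj_gen_rank finite_imageD finite_subset by blast
qed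

type_synonym superfield = "gen grassmann"


section \<open>Spinors and kinematics\<close>

definition eps_up :: "2 \<Rightarrow> 2 \<Rightarrow> complex" where
  "eps_up a b = (if a = 1 \<and> b = 2 then 1 else if a = 2 \<and> b = 1 then -1 else 0)"

definition eps_dn :: "2 \<Rightarrow> 2 \<Rightarrow> complex" where
  "eps_dn a b = (if a = 1 \<and> b = 2 then -1 else if a = 2 \<and> b = 1 then 1 else 0)"

text \<open>Both dotted and undotted spinors are given by their lower components.\<close>

type_synonym spinor = "complex ^ 2"

definition raise_ix :: "spinor \<Rightarrow> spinor" where
  "raise_ix v = (\<chi> a. \<Sum>b\<in>UNIV. eps_up a b * v $ b)"

definition angle_br :: "spinor \<Rightarrow> spinor \<Rightarrow> complex" where
  "angle_br v w = (\<Sum>a\<in>UNIV. raise_ix v $ a * w $ a)"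

definition square_br :: "spinor \<Rightarrow> spinor \<Rightarrow> complex" where
  "square_br v w = (\<Sum>a\<in>UNIV. v $ a * raise_ix w $ a)"

text \<open>\<open>lam i I\<close> and \<open>lamt i I\<close> are the undotted and dotted massive spinors with upper little group
  index \<open>I\<close>; rows of momentum matrices are undotted, columns dotted.\<close>

definition massive_momentum ::
  "(2 \<Rightarrow> 2 \<Rightarrow> spinor) \<Rightarrow> (2 \<Rightarrow> 2 \<Rightarrow> spinor) \<Rightarrow> 2 \<Rightarrow> complex ^ 2 ^ 2" where
  "massive_momentum lam lamt i =
     (\<chi> a b. \<Sum>I\<in>UNIV. \<Sum>J\<in>UNIV. lam i I $ a * eps_dn I J * lamt i J $ b)"

definition massless_momentum :: "spinor \<Rightarrow> spinor \<Rightarrow> complex ^ 2 ^ 2" where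
  "massless_momentum lP lPt = (\<chi> a b. lP $ a * lPt $ b)"


section \<open>Superamplitudes\<close>

definition leg_sign :: "2 \<Rightarrow> complex" where
  "leg_sign i = (if i = 1 then 1 else -1)"

definition super_delta :: "(2 \<Rightarrow> 2 \<Rightarrow> spinor) \<Rightarrow> spinor \<Rightarrow> 4 \<Rightarrow> superfield" where
  "super_delta lam lP A =
     (\<Sum>i\<in>UNIV. \<Sum>I\<in>UNIV. angle_br lP (lam i I) *\<^sub>G eta (Eta i I A))"

definition super_H :: "(2 \<Rightarrow> 2 \<Rightarrow> spinor) \<Rightarrow> spinor \<Rightarrow> spinor \<Rightarrow> 4 \<Rightarrow> superfield" where
  "super_H lam lP zeta A =
     (1 / angle_br zeta lP) *\<^sub>G
       (\<Sum>i\<in>UNIV. \<Sum>I\<in>UNIV. angle_br zeta (lam i I) *\<^sub>G eta (Eta i I A))"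

definition super_Hbar :: "(2 \<Rightarrow> 2 \<Rightarrow> spinor) \<Rightarrow> spinor \<Rightarrow> spinor \<Rightarrow> 4 \<Rightarrow> superfield" where
  "super_Hbar lamt lPt xi A =
     (1 / square_br xi lPt) *\<^sub>G
       (\<Sum>i\<in>UNIV. \<Sum>I\<in>UNIV. (square_br xi (lamt i I) * leg_sign i) *\<^sub>G eta (Eta i I A))"

text \<open>In the next two definitions \<open>d\<close>, \<open>H\<close>, \<open>Hb\<close> stand for \<open>super_delta\<close>, \<open>super_H\<close>,
  \<open>super_Hbar\<close> (upper flavour index), and \<open>Ha\<close>, \<open>Hb'\<close> for the latter with lower index \<open>a\<close>, \<open>b\<close>.\<close>

definition S1 :: "real \<Rightarrow> (4 \<Rightarrow> superfield) \<Rightarrow> (4 \<Rightarrow> superfield) \<Rightarrow> (4 \<Rightarrow> superfield) \<Rightarrow>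
    4 \<Rightarrow> 4 \<Rightarrow> superfield" where
  "S1 \<theta> d H Hb a b =
    (let c = complex_of_real (cos \<theta>); s = complex_of_real (sin \<theta>);
         Ha = - Hb b; Hb' = Hb a; ea = eta (EtaP a); eb = eta (EtaP b)
     in (c *\<^sub>G (ea * d a) - d a * H a - (c * s) *\<^sub>G (d a * Hb' * ea * eb)
           + s *\<^sub>G (d a * H a * Hb' * eb))
      * (c *\<^sub>G (eb * d b) - d b * H b + (c * s) *\<^sub>G (d b * Ha * ea * eb)
           + s *\<^sub>G (d b * H b * Ha * ea)))"

definition S2 :: "complex \<Rightarrow> real \<Rightarrow> (4 \<Rightarrow> superfield) \<Rightarrow> (4 \<Rightarrow> superfield) \<Rightarrow>
    (4 \<Rightarrow> superfield) \<Rightarrow> 4 \<Rightarrow> 4 \<Rightarrow> superfield" where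
  "S2 x \<theta> d H Hb a b =
    (let c = complex_of_real (cos \<theta>); s = complex_of_real (sin \<theta>);
         Ha = - Hb b; Hb' = Hb a; ea = eta (EtaP a); eb = eta (EtaP b)
     in (- x) *\<^sub>G
        ((c *\<^sub>G (d a * H a * Ha) + d a * ea * Ha + s *\<^sub>G d a)
       * (c *\<^sub>G (d b * H b * Hb') + d b * eb * Hb' + s *\<^sub>G d b)))"

definition superamp_plus2 :: "complex \<Rightarrow> real \<Rightarrow> (2 \<Rightarrow> 2 \<Rightarrow> spinor) \<Rightarrow> (2 \<Rightarrow> 2 \<Rightarrow> spinor) \<Rightarrow>
    spinor \<Rightarrow> spinor \<Rightarrow> complex \<Rightarrow> spinor \<Rightarrow> spinor \<Rightarrow> real \<Rightarrow> real \<Rightarrow> superfield" where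
  "superamp_plus2 \<kappa> m lam lamt lP lPt x zeta xi \<theta>12 \<theta>34 =
    (let d = super_delta lam lP; H = super_H lam lP zeta; Hb = super_Hbar lamt lPt xi
     in (\<kappa> / (2 * complex_of_real m ^ 2) * x ^ 2) *\<^sub>G (S1 \<theta>12 d H Hb 1 2 * S1 \<theta>34 d H Hb 3 4))"

definition superamp_zero :: "complex \<Rightarrow> real \<Rightarrow> (2 \<Rightarrow> 2 \<Rightarrow> spinor) \<Rightarrow> (2 \<Rightarrow> 2 \<Rightarrow> spinor) \<Rightarrow>
    spinor \<Rightarrow> spinor \<Rightarrow> complex \<Rightarrow> spinor \<Rightarrow> spinor \<Rightarrow> real \<Rightarrow> real \<Rightarrow> superfield" where
  "superamp_zero \<kappa> m lam lamt lP lPt x zeta xi \<theta>12 \<theta>34 =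
    (let d = super_delta lam lP; H = super_H lam lP zeta; Hb = super_Hbar lamt lPt xi
     in (\<kappa> / (2 * complex_of_real m ^ 2)) *\<^sub>G (S2 x \<theta>12 d H Hb 1 2 * S2 x \<theta>34 d H Hb 3 4))"


section \<open>Components\<close>

definition etaP_free_part :: "superfield \<Rightarrow> superfield" where
  "etaP_free_part f = Grass (\<lambda>S. if S \<inter> range EtaP = {} then gcoeff f S else 0)"

text \<open>The generators \<open>EtaP 1 < EtaP 2 < EtaP 3 < EtaP 4\<close> come last in the order, so no sign appears
  in the coefficient of their product.\<close>

definition etaP_top_coeff :: "superfield \<Rightarrow> superfield" where
  "etaP_top_coeff f =
     Grass (\<lambda>S. if S \<inter> range EtaP = {} then gcoeff f (S \<union> range EtaP) else 0)"

definition leg_algebra :: "2 \<Rightarrow> superfield set" where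
  "leg_algebra i = {f. \<forall>S. gcoeff f S \<noteq> 0 \<longrightarrow> S \<subseteq> {Eta i I A | I A. True}}"

definition SU2 :: "(complex ^ 2 ^ 2) set" where
  "SU2 = {U. U ** (\<chi> a b. cnj (U $ b $ a)) = mat 1 \<and> det U = 1}"

definition little_group :: "2 \<Rightarrow> complex ^ 2 ^ 2 \<Rightarrow> superfield \<Rightarrow> superfield" where
  "little_group i U =
     gsubst (\<lambda>g. case g of
         Eta j I A \<Rightarrow> if j = i then \<Sum>J\<in>UNIV. (U $ J $ I) *\<^sub>G eta (Eta i J A) else eta g
       | EtaP A \<Rightarrow> eta g)"

text \<open>A tensor with \<open>n\<close> little group indices is a function of index lists of length \<open>n\<close>; it is
  symmetric iff it depends only on the multiset of the indices. A pair \<open>(n, \<phi>)\<close> describes a copy of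
  the spin \<open>n/2\<close> representation (the \<open>n\<close>-th symmetric power of the defining one) in the exterior
  algebra of leg \<open>i\<close>, by the images \<open>\<phi> I\<close> of the symmetrized products of basis vectors. As this
  representation is irreducible, \<open>\<phi> \<noteq> 0\<close> makes the equivariant map injective.\<close>

type_synonym massive_state = "nat \<times> (2 list \<Rightarrow> superfield)"

definition spin_copy :: "2 \<Rightarrow> massive_state \<Rightarrow> bool" where
  "spin_copy i = (\<lambda>(n, \<phi>).
     (\<forall>I. length I = n \<longrightarrow> \<phi> I \<in> leg_algebra i) \<and>
     (\<forall>I J. length I = n \<and> mset I = mset J \<longrightarrow> \<phi> I = \<phi> J) \<and>
     (\<forall>U\<in>SU2. \<forall>I. length I = n \<longrightarrow>
        little_group i U (\<phi> I) =
          (\<Sum>J | length J = n. (\<Prod>k<n. U $ (J ! k) $ (I ! k)) *\<^sub>G \<phi> J)) \<and>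
     (\<exists>I. length I = n \<and> \<phi> I \<noteq> 0))"

text \<open>The exterior algebra of leg \<open>i\<close> is the direct sum of the listed copies: each element has a
  unique expansion with symmetric coefficient tensors.\<close>

definition little_group_decomposition :: "2 \<Rightarrow> massive_state list \<Rightarrow> bool" where
  "little_group_decomposition i D \<longleftrightarrow>
     (\<forall>d\<in>set D. spin_copy i d) \<and>
     (\<forall>f\<in>leg_algebra i. \<exists>!c :: nat \<Rightarrow> 2 list \<Rightarrow> complex.
        (\<forall>k I. \<not> (k < length D \<and> length I = fst (D ! k)) \<longrightarrow> c k I = 0) \<and>
        (\<forall>k I J. mset I = mset J \<longrightarrow> c k I = c k J) \<and>
        f = (\<Sum>k<length D. \<Sum>I | length I = fst (D ! k). c k I *\<^sub>G snd (D ! k) I))"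

text \<open>\<open>C k l I J\<close> is the component amplitude of the superfield \<open>f\<close> (with the massless leg already
  projected out) for the \<open>k\<close>-th state of leg 1 and the \<open>l\<close>-th state of leg 2.\<close>

definition component_amplitudes :: "massive_state list \<Rightarrow> massive_state list \<Rightarrow> superfield \<Rightarrow>
    (nat \<Rightarrow> nat \<Rightarrow> 2 list \<Rightarrow> 2 list \<Rightarrow> complex) \<Rightarrow> bool" where
  "component_amplitudes D1 D2 f C \<longleftrightarrow>
     (\<forall>k l I I' J J'. mset I = mset I' \<and> mset J = mset J' \<longrightarrow> C k l I J = C k l I' J') \<and>
     f = (\<Sum>k<length D1. \<Sum>l<length D2.
            \<Sum>I | length I = fst (D1 ! k). \<Sum>J | length J = fst (D2 ! l).
              C k l I J *\<^sub>G (snd (D1 ! k) I * snd (D2 ! l) J))"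

text \<open>The \<open>n\<close>-th power of a bracket \<open>B I J\<close>, symmetrized in both sets of little group indices.\<close>

definition sym_power :: "(2 \<Rightarrow> 2 \<Rightarrow> complex) \<Rightarrow> nat \<Rightarrow> 2 list \<Rightarrow> 2 list \<Rightarrow> complex" where
  "sym_power B n I J =
     (\<Sum>\<pi> | \<pi> permutes {..<n}. \<Sum>\<tau> | \<tau> permutes {..<n}. \<Prod>k<n. B (I ! \<pi> k) (J ! \<tau> k)) / fact n ^ 2"

text \<open>All component amplitudes of \<open>f\<close> vanish unless the two spins agree, in which case they are
  constant multiples of \<open>y\<close> times the symmetrized power of \<open>B\<close>.\<close>

definition minimally_coupled :: "superfield \<Rightarrow> complex \<Rightarrow> (2 \<Rightarrow> 2 \<Rightarrow> complex) \<Rightarrow> bool" where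
  "minimally_coupled f y B \<longleftrightarrow>
     (\<forall>D1 D2 C. little_group_decomposition 1 D1 \<longrightarrow> little_group_decomposition 2 D2 \<longrightarrow>
        component_amplitudes D1 D2 f C \<longrightarrow>
        (\<forall>k<length D1. \<forall>l<length D2.
           (fst (D1 ! k) \<noteq> fst (D2 ! l) \<longrightarrow>
              (\<forall>I J. length I = fst (D1 ! k) \<longrightarrow> length J = fst (D2 ! l) \<longrightarrow> C k l I J = 0)) \<and>
           (fst (D1 ! k) = fst (D2 ! l) \<longrightarrow>
              (\<exists>K. \<forall>I J. length I = fst (D1 ! k) \<longrightarrow> length J = fst (D2 ! l) \<longrightarrow>
                 C k l I J = K * (y * sym_power B (fst (D1 ! k)) I J)))))"

end

theory Submission
  imports Defs "HOL-Complex_Analysis.Conformal_Mappings" "HOL-Combinatorics.Permutations"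
begin

text \<open>Write \<open>\<theta>\<^sub>\<alpha> = \<Sum>\<^sub>i \<lambda>\<^sup>I\<^sub>i\<^sub>\<alpha> \<eta>\<^sub>i\<^sub>I\<close> and \<open>\<theta>'\<^sub>\<alpha>\<close> for the same sum with \<open>\<sigma>\<^sub>i\<close> times the
  dotted spinors. For each flavour \<open>\<delta>\<close>, \<open>H\<close> are linear combinations of \<open>\<theta>\<^sub>1\<close>, \<open>\<theta>\<^sub>2\<close> and,
  since the kinematics gives \<open>x \<langle>P i\<rangle> = \<sigma>\<^sub>i [i P]\<close>, also \<open>\<delta>\<close>, \<open>Hbar\<close> are combinations of
  \<open>\<theta>'\<^sub>1\<close>, \<open>\<theta>'\<^sub>2\<close>; one finds \<open>\<delta> H = \<theta>\<^sub>1 \<theta>\<^sub>2\<close> and \<open>\<delta> Hbar = x\<^sup>-\<^sup>1 \<theta>'\<^sub>1 \<theta>'\<^sub>2\<close>. The graviton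
  components of the superamplitudes are, up to a constant, the products of these over the four
  flavours. A matrix \<open>g\<close> of determinant 1 acting on the spinor index fixes \<open>\<theta>\<^sub>1 \<theta>\<^sub>2\<close>, and its action
  can be traded for complexified little group transformations of the two legs. Equivariance under
  \<open>SU(2)\<close> extends to \<open>SL(2, \<complex>)\<close> by analytic continuation, so a component amplitude, read
  as a bihomogeneous form \<open>F(u, v)\<close>, is invariant under the diagonal action of \<open>SL(2, \<complex>)\<close> on
  the pair \<open>(\<lambda>\<^sub>1 u, \<lambda>\<^sub>2 v)\<close>. Pairs with a given non-zero determinant form one orbit, hence \<open>F\<close> is
  a power of that determinant, i.e. of the bracket, and its two degrees agree unless \<open>F = 0\<close>.\<close>

section \<open>Substitution homomorphisms\<close>

lemma gcoeff_ops [simp]: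
  fixes f g :: "'g::{finite,linorder} grassmann"
  shows "gcoeff (0 :: 'g grassmann) S = 0"
    and "gcoeff (f + g) S = gcoeff f S + gcoeff g S"
    and "gcoeff (- f) S = - gcoeff f S"
    and "gcoeff (f - g) S = gcoeff f S - gcoeff g S"
  by (simp_all add: grassmann_defs)

lemma gcoeff_gscale [simp]: "gcoeff (z *\<^sub>G f) S = z * gcoeff f S"
  by (simp add: gscale_def)

lemma gcoeff_one: "gcoeff (1 :: 'g::{finite,linorder} grassmann) S = (if S = {} then 1 else 0)"
  by (simp add: one_grassmann_def)

lemma gcoeff_times:
  fixes f g :: "'g::{finite,linorder} grassmann"
  shows "gcoeff (f * g) S = (\<Sum>T\<in>Pow S. gsign T (S - T) * gcoeff f T * gcoeff g (S - T))"
  by (simp add: times_grassmann_def)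

lemma gcoeff_sum [simp]:
  fixes f :: "'i \<Rightarrow> 'g::{finite,linorder} grassmann"
  shows "gcoeff (\<Sum>i\<in>A. f i) S = (\<Sum>i\<in>A. gcoeff (f i) S)"
  by (induction A rule: infinite_finite_induct) auto

lemma gscale_simps:
  fixes f g :: "'g::{finite,linorder} grassmann"
  shows "z *\<^sub>G (f + g) = z *\<^sub>G f + z *\<^sub>G g"
    and "(z + w) *\<^sub>G f = z *\<^sub>G f + w *\<^sub>G f"
    and "z *\<^sub>G (f - g) = z *\<^sub>G f - z *\<^sub>G g"
    and "z *\<^sub>G (- f) = - (z *\<^sub>G f)"
    and "z *\<^sub>G (0 :: 'g grassmann) = 0"
    and "1 *\<^sub>G f = f"
    and "0 *\<^sub>G f = 0"
    and "z *\<^sub>G w *\<^sub>G f = (z * w) *\<^sub>G f"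
    and "(- z) *\<^sub>G f = - (z *\<^sub>G f)"
  by (rule grassmann_eqI; simp add: algebra_simps)+

lemma gscale_mult:
  fixes f g :: "'g::{finite,linorder} grassmann"
  shows "(z *\<^sub>G f) * g = z *\<^sub>G (f * g)" "f * (z *\<^sub>G g) = z *\<^sub>G (f * g)"
  by (rule grassmann_eqI; simp add: gcoeff_times sum_distrib_left algebra_simps)+

lemma gscale_sum:
  fixes f :: "'i \<Rightarrow> 'g::{finite,linorder} grassmann"
  shows "z *\<^sub>G (\<Sum>i\<in>A. f i) = (\<Sum>i\<in>A. z *\<^sub>G f i)"
  by (rule grassmann_eqI) (simp add: sum_distrib_left)

lemma gscale_sum_left:
  fixes f :: "'g::{finite,linorder} grassmann"
  shows "(\<Sum>i\<in>A. z i) *\<^sub>G f = (\<Sum>i\<in>A. z i *\<^sub>G f)"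
  by (rule grassmann_eqI) (simp add: sum_distrib_right)

section \<open>Ordered monomials and multiplicativity of substitutions\<close>

definition gmono :: "'g set \<Rightarrow> 'g grassmann" where
  "gmono S = Grass (\<lambda>T. if T = S then 1 else 0)"

lemma gcoeff_gmono: "gcoeff (gmono S) T = (if T = S then 1 else 0)"
  by (simp add: gmono_def)

lemma gmono_eq_prod_list:
  "gmono (S :: 'g::{finite,linorder} set) = prod_list (map eta (sorted_list_of_set S))"
  by (simp add: gmono_def eta_monomial)

lemma grassmann_expand:
  fixes f :: "'g::{finite,linorder} grassmann"
  shows "f = (\<Sum>S\<in>UNIV. gcoeff f S *\<^sub>G gmono S)"
  by (rule grassmann_eqI) (simp add: gcoeff_gmono if_distrib cong: if_cong)

lemma gsubst_add:
  "gsubst h (f + g) = gsubst h f + gsubst h (g :: 'g::{finite,linorder} grassmann)"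
  unfolding gsubst_def by (simp add: gscale_simps sum.distrib)

lemma gsubst_scale: "gsubst h (z *\<^sub>G f) = z *\<^sub>G gsubst h f"
  unfolding gsubst_def by (simp add: gscale_simps gscale_sum)

lemma gsubst_zero: "gsubst h (0 :: 'g::{finite,linorder} grassmann) = 0"
  unfolding gsubst_def by (simp add: gscale_simps)

lemma gsubst_sum:
  fixes f :: "'i \<Rightarrow> 'g::{finite,linorder} grassmann"
  shows "gsubst h (\<Sum>i\<in>A. f i) = (\<Sum>i\<in>A. gsubst h (f i))"
  by (induction A rule: infinite_finite_induct) (auto simp: gsubst_add gsubst_zero)

lemma gsubst_gmono: "gsubst h (gmono S) = prod_list (map h (sorted_list_of_set S))"
proof -
  have "gsubst h (gmono S) =
      (\<Sum>T\<in>UNIV. if T = S then prod_list (map h (sorted_list_of_set T)) else 0)"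
    unfolding gsubst_def by (rule sum.cong) (auto simp: gcoeff_gmono gscale_simps)
  then show ?thesis by simp
qed

text \<open>Lets a transformation of both legs be replaced by one of a single leg on elements that
  involve only that leg.\<close>

lemma gsubst_cong:
  assumes "\<And>S g. gcoeff f S \<noteq> 0 \<Longrightarrow> g \<in> S \<Longrightarrow> h g = h' g"
  shows "gsubst h f = gsubst h' f"
  unfolding gsubst_def
proof (rule sum.cong[OF refl])
  fix S
  show "gcoeff f S *\<^sub>G prod_list (map h (sorted_list_of_set S)) =
      gcoeff f S *\<^sub>G prod_list (map h' (sorted_list_of_set S))"
  proof (cases "gcoeff f S = 0")
    case False
    then have "map h (sorted_list_of_set S) = map h' (sorted_list_of_set S)"
      using assms by (intro map_cong) (auto dest: set_sorted_list_of_set[THEN equalityD1, THEN subsetD, rotated])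
    then show ?thesis by (simp only:)
  qed (simp add: gscale_simps)
qed

lemma anticommute_square:
  fixes a :: "'g::{finite,linorder} grassmann"
  assumes "a * a = - (a * a)"
  shows "a * a = 0"
proof (rule grassmann_eqI)
  fix S
  have "gcoeff (a * a) S = - gcoeff (a * a) S" using assms by (metis gcoeff_ops(3))
  then show "gcoeff (a * a) S = gcoeff 0 S" by simp
qed

text \<open>Moving \<open>h g\<close> to its sorted place costs one sign for each smaller generator
  that it passes, which is what \<open>inversions\<close> counts; meeting \<open>g\<close> itself
  produces \<open>h g * h g = 0\<close>. Both \<open>eta\<close> and any anticommuting
  \<open>h\<close> qualify, with the same sign.\<close>

lemma mult_prod_list_insort:
  fixes h :: "'g::{finite,linorder} \<Rightarrow> 'g grassmann"
  assumes anti: "\<And>g g'. h g * h g' = - (h g' * h g)"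
  shows "sorted_wrt (<) xs \<Longrightarrow> h g * prod_list (map h xs) =
    (if g \<in> set xs then 0 else gsign {g} (set xs) *\<^sub>G prod_list (map h (insort g xs)))"
proof (induction xs)
  case Nil
  then show ?case by (simp add: gscale_simps)
next
  case (Cons x xs)
  have x: "\<forall>y\<in>set xs. x < y" "x \<notin> set xs" using Cons.prems by auto
  consider "g = x" | "g < x" | "x < g" by (rule linorder_cases)
  then show ?case
  proof cases
    case 1
    have "h g * h g = 0" by (rule anticommute_square) (rule anti)
    then show ?thesis using 1 by (simp flip: mult.assoc)
  next
    case 2
    have "inversions {g} (set (x # xs)) = 0"
      unfolding inversions_def using 2 x by (auto dest: less_asym)
    moreover have "g \<notin> set (x # xs)" using 2 x by auto
    ultimately show ?thesis using 2 by (simp add: gsign_def gscale_simps less_imp_le)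
  next
    case 3
    have 1: "inversions {g} {x} = 1"
    proof -
      have "{(s, t). s \<in> {g} \<and> t \<in> {x} \<and> t < s} = {(g, x)}" using 3 by auto
      then show ?thesis by (simp add: inversions_def)
    qed
    have "inversions {g} ({x} \<union> set xs) = 1 + inversions {g} (set xs)"
      using x by (subst inversions_Un2) (auto simp: 1)
    then have s: "gsign {g} (set (x # xs)) = - gsign {g} (set xs)" by (simp add: gsign_def)
    have "h g * prod_list (map h (x # xs)) = - (h x * (h g * prod_list (map h xs)))"
      using anti[of g x] by (simp flip: mult.assoc)
    also have "\<dots> = - (h x * (if g \<in> set xs then 0
        else gsign {g} (set xs) *\<^sub>G prod_list (map h (insort g xs))))"
      using Cons by simp
    finally show ?thesis using 3 s by (auto simp: gscale_mult gscale_simps)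
  qed
qed

text \<open>Inserting \<open>g\<close> into a monomial gives the same sign, and vanishes in the same
  cases, for \<open>eta\<close> and for \<open>h\<close>. This settles monomials, and linearity does
  the rest.\<close>

lemma gsubst_eta_mult:
  fixes h :: "'g::{finite,linorder} \<Rightarrow> 'g grassmann"
  assumes anti: "\<And>g g'. h g * h g' = - (h g' * h g)"
  shows "gsubst h (eta g * f) = h g * gsubst h f"
proof -
  have mono: "gsubst h (eta g * gmono S) = h g * gsubst h (gmono S)" for S
  proof (cases "g \<in> S")
    case False
    then have "sorted_list_of_set (insert g S) = insort g (sorted_list_of_set S)"
      by (simp add: sorted_list_of_set_insert)
    moreover from this have "gsubst h (prod_list (map eta (insort g (sorted_list_of_set S)))) =
        prod_list (map h (insort g (sorted_list_of_set S)))"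
      using gsubst_gmono[of h "insert g S"] by (simp only: gmono_eq_prod_list)
    ultimately show ?thesis
      using mult_prod_list_insort[of eta "sorted_list_of_set S" g, OF eta_anticommute]
        mult_prod_list_insort[of h "sorted_list_of_set S" g, OF anti] False
      by (simp add: gmono_eq_prod_list[symmetric] gsubst_gmono gsubst_scale)
  next
    case True
    then show ?thesis
      using mult_prod_list_insort[of eta "sorted_list_of_set S" g, OF eta_anticommute]
        mult_prod_list_insort[of h "sorted_list_of_set S" g, OF anti]
      by (simp add: gmono_eq_prod_list[symmetric] gsubst_gmono gsubst_zero)
  qed
  have "gsubst h (eta g * f) = gsubst h (eta g * (\<Sum>S\<in>UNIV. gcoeff f S *\<^sub>G gmono S))"
    by (simp flip: grassmann_expand)
  also have "\<dots> = h g * gsubst h (\<Sum>S\<in>UNIV. gcoeff f S *\<^sub>G gmono S)"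
    by (simp add: sum_distrib_left gscale_mult gsubst_sum gsubst_scale mono)
  finally show ?thesis by (simp flip: grassmann_expand)
qed

text \<open>The monomials of the left factor are peeled off one generator at a time.\<close>

lemma gsubst_mult:
  fixes h :: "'g::{finite,linorder} \<Rightarrow> 'g grassmann"
  assumes anti: "\<And>g g'. h g * h g' = - (h g' * h g)"
  shows "gsubst h (f * f') = gsubst h f * gsubst h f'"
proof -
  have list: "gsubst h (prod_list (map eta xs) * k) = prod_list (map h xs) * gsubst h k" for xs k
    by (induction xs) (simp_all add: mult.assoc gsubst_eta_mult[OF anti])
  have "gsubst h (f * f') = gsubst h ((\<Sum>S\<in>UNIV. gcoeff f S *\<^sub>G gmono S) * f')"
    by (simp flip: grassmann_expand)
  also have "\<dots> = gsubst h (\<Sum>S\<in>UNIV. gcoeff f S *\<^sub>G gmono S) * gsubst h f'"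
    by (simp add: sum_distrib_right gscale_mult gsubst_sum gsubst_scale gsubst_gmono)
      (simp add: gmono_eq_prod_list list)
  finally show ?thesis by (simp flip: grassmann_expand)
qed

lemma gsubst_one: "gsubst h 1 = (1 :: 'g::{finite,linorder} grassmann)"
  using gsubst_gmono[of h "{}"] by (simp add: gmono_def one_grassmann_def)

lemma gsubst_eta: "gsubst h (eta g) = (h g :: 'g::{finite,linorder} grassmann)"
proof -
  have "eta g = gmono {g}" by (simp add: eta_def gmono_def)
  then show ?thesis by (simp add: gsubst_gmono)
qed

text \<open>The inner substitution is unfolded on ordered monomials; anticommutation of the outer
  images lets \<open>gsubst h\<close> pass through the resulting products.\<close>

lemma gsubst_compose:
  fixes h k :: "'g::{finite,linorder} \<Rightarrow> 'g grassmann"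
  assumes anti: "\<And>g g'. h g * h g' = - (h g' * h g)"
  shows "gsubst h (gsubst k f) = gsubst (\<lambda>g. gsubst h (k g)) f"
proof -
  have list: "gsubst h (prod_list (map k xs)) = prod_list (map (\<lambda>g. gsubst h (k g)) xs)" for xs
    by (induction xs) (simp_all add: gsubst_one gsubst_mult[OF anti])
  show ?thesis
    unfolding gsubst_def[of k] by (simp add: gsubst_sum gsubst_scale list) (simp add: gsubst_def)
qed

section \<open>Anticommuting linear combinations of generators\<close>

definition generator_span :: "'g::{finite,linorder} grassmann set" where
  "generator_span = {f. \<exists>c. f = (\<Sum>g\<in>UNIV. c g *\<^sub>G eta g)}"

lemma eta_in_span: "eta g \<in> generator_span"
proof -
  have "eta g = (\<Sum>g'\<in>UNIV. (if g' = g then 1 else 0) *\<^sub>G eta g')"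
    by (rule grassmann_eqI) (simp add: if_distrib if_distribR cong: if_cong)
  then show ?thesis unfolding generator_span_def by (intro CollectI exI)
qed

lemma generator_span_closed:
  fixes f g :: "'g::{finite,linorder} grassmann"
  shows "f \<in> generator_span \<Longrightarrow> g \<in> generator_span \<Longrightarrow> f + g \<in> generator_span"
    and "f \<in> generator_span \<Longrightarrow> z *\<^sub>G f \<in> generator_span"
    and "0 \<in> (generator_span :: 'g grassmann set)"
proof -
  show "0 \<in> (generator_span :: 'g grassmann set)"
    unfolding generator_span_def by (auto intro!: exI[of _ "\<lambda>_. 0"] simp: gscale_simps)
  show "z *\<^sub>G f \<in> generator_span" if f: "f \<in> generator_span"
  proof -
    obtain c where "f = (\<Sum>g\<in>UNIV. c g *\<^sub>G eta g)" using f unfolding generator_span_def by (elim CollectE exE)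
    then have "z *\<^sub>G f = (\<Sum>g\<in>UNIV. (z * c g) *\<^sub>G eta g)" by (simp add: gscale_sum gscale_simps)
    then show ?thesis unfolding generator_span_def by (intro CollectI exI)
  qed
  show "f + g \<in> generator_span" if f: "f \<in> generator_span" and g: "g \<in> generator_span"
  proof -
    obtain c where c: "f = (\<Sum>g\<in>UNIV. c g *\<^sub>G eta g)"
      using f unfolding generator_span_def by (elim CollectE exE)
    obtain d where d: "g = (\<Sum>g\<in>UNIV. d g *\<^sub>G eta g)"
      using g unfolding generator_span_def by blast
    have "f + g = (\<Sum>g\<in>UNIV. (c g + d g) *\<^sub>G eta g)"
      unfolding c d by (simp add: gscale_simps sum.distrib)
    then show ?thesis unfolding generator_span_def by (intro CollectI exI)
  qed
qed

lemma generator_span_sum: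
  "(\<And>i. i \<in> A \<Longrightarrow> f i \<in> generator_span) \<Longrightarrow> (\<Sum>i\<in>A. f i) \<in> generator_span"
  by (induction A rule: infinite_finite_induct) (auto intro: generator_span_closed)

lemma generator_span_anticommute:
  assumes "f \<in> generator_span" "g \<in> generator_span"
  shows "f * g = - (g * f)"
proof -
  obtain c where c: "f = (\<Sum>g\<in>UNIV. c g *\<^sub>G eta g)"
    using assms(1) unfolding generator_span_def by blast
  obtain d where d: "g = (\<Sum>g\<in>UNIV. d g *\<^sub>G eta g)"
    using assms(2) unfolding generator_span_def by blast
  have "f * g = (\<Sum>a\<in>UNIV. \<Sum>b\<in>UNIV. (d b * c a) *\<^sub>G (eta a * eta b))"
    unfolding c d by (simp add: sum_product gscale_mult gscale_simps mult.commute)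
  also have "\<dots> = (\<Sum>a\<in>UNIV. \<Sum>b\<in>UNIV. - ((d b * c a) *\<^sub>G (eta b * eta a)))"
    by (intro sum.cong refl) (subst eta_anticommute, simp add: gscale_simps)
  also have "\<dots> = - (\<Sum>b\<in>UNIV. \<Sum>a\<in>UNIV. (d b * c a) *\<^sub>G (eta b * eta a))"
    by (subst sum.swap) (simp add: sum_negf)
  also have "\<dots> = - (g * f)"
    unfolding c d by (simp add: sum_product gscale_mult gscale_simps mult.commute)
  finally show ?thesis .
qed

section \<open>Equivariance under the complexified little group\<close>

lemma finite_lists_length [simp]: "finite {I :: 'a::finite list. length I = n}"
  using finite_lists_length_eq[of "UNIV :: 'a set" n] by simp

text \<open>Distributive law: the list \<open>I\<close> records which summand is taken from each
  factor. It makes tensor powers of matrices multiply slot by slot.\<close>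

lemma sum_lists_prod:
  fixes g :: "nat \<Rightarrow> 'a::finite \<Rightarrow> 'b::comm_semiring_1"
  shows "(\<Sum>I | length I = n. \<Prod>k<n. g k (I ! k)) = (\<Prod>k<n. \<Sum>j\<in>UNIV. g k j)"
proof (induction n arbitrary: g)
  case (Suc n)
  have "(\<Sum>I | length I = Suc n. \<Prod>k<Suc n. g k (I ! k)) =
      (\<Sum>(j, I)\<in>UNIV \<times> {I. length I = n}. \<Prod>k<Suc n. g k ((j # I) ! k))"
    by (rule sum.reindex_bij_witness[where i = "\<lambda>(j, I). j # I" and j = "\<lambda>I. (hd I, tl I)"])
      (auto simp: length_Suc_conv)
  also have "\<dots> = (\<Sum>j\<in>UNIV. g 0 j * (\<Sum>I | length I = n. \<Prod>k<n. g (Suc k) (I ! k)))"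
    by (simp add: prod.lessThan_Suc_shift sum_distrib_left sum.cartesian_product
        del: prod.lessThan_Suc)
  also have "\<dots> = (\<Prod>k<Suc n. \<Sum>j\<in>UNIV. g k j)"
    using Suc.IH[of "\<lambda>k. g (Suc k)"]
    by (simp add: prod.lessThan_Suc_shift sum_distrib_right del: prod.lessThan_Suc)
  finally show ?case .
qed simp

text \<open>Acts on both legs at once with independent matrices \<open>W 1\<close> and
  \<open>W 2\<close>, in the index convention of \<open>little_group\<close>. No unitarity is built
  in, so complexified transformations are covered.\<close>

definition gact :: "(2 \<Rightarrow> complex ^ 2 ^ 2) \<Rightarrow> gen \<Rightarrow> superfield" where
  "gact W g = (case g of
     Eta i I A \<Rightarrow> \<Sum>J\<in>UNIV. (W i $ J $ I) *\<^sub>G eta (Eta i J A) | EtaP A \<Rightarrow> eta g)"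

lemma gact_anticommute: "gact W g * gact W g' = - (gact W g' * gact W g)"
proof -
  have "gact W g \<in> generator_span" for g
    unfolding gact_def by (cases g) (auto intro!: generator_span_sum generator_span_closed eta_in_span)
  then show ?thesis by (intro generator_span_anticommute)
qed

lemmas gsubst_gact_mult = gsubst_mult[OF gact_anticommute]

lemma gact_mat_1: "W i = mat 1 \<Longrightarrow> gact W (Eta i I A) = eta (Eta i I A)"
  by (rule grassmann_eqI) (simp add: gact_def mat_def if_distrib if_distribR cong: if_cong)

lemma little_group_eq_gact: "little_group i U = gsubst (gact ((\<lambda>_. mat 1)(i := U)))"
proof -
  have "(case g of Eta j I A \<Rightarrow> if j = i then \<Sum>J\<in>UNIV. (U $ J $ I) *\<^sub>G eta (Eta i J A) else eta g
       | EtaP A \<Rightarrow> eta g) = gact ((\<lambda>_. mat 1)(i := U)) g" for g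
    using gact_mat_1[of "(\<lambda>_. mat 1)(i := U)"] by (cases g) (auto simp: gact_def)
  then show ?thesis unfolding little_group_def by presburger
qed

lemma gsubst_gact_compose:
  "gsubst (gact W) (gsubst (gact W') f) = gsubst (gact (\<lambda>i. W i ** W' i)) f"
proof -
  have "gsubst (gact W) (gact W' g) = gact (\<lambda>i. W i ** W' i) g" for g
  proof (cases g)
    case (Eta i I A)
    have "gsubst (gact W) (gact W' g) =
        (\<Sum>J\<in>UNIV. \<Sum>K\<in>UNIV. (W' i $ J $ I * W i $ K $ J) *\<^sub>G eta (Eta i K A))"
      by (simp add: Eta gact_def gsubst_sum gsubst_scale gsubst_eta gscale_sum gscale_simps)
    also have "\<dots> = (\<Sum>K\<in>UNIV. \<Sum>J\<in>UNIV. (W' i $ J $ I * W i $ K $ J) *\<^sub>G eta (Eta i K A))"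
      by (rule sum.swap)
    also have "\<dots> = gact (\<lambda>i. W i ** W' i) g"
      by (simp add: Eta gact_def matrix_matrix_mult_def gscale_sum_left mult.commute)
    finally show ?thesis .
  qed (simp add: gact_def gsubst_eta)
  then show ?thesis by (simp add: gsubst_compose[OF gact_anticommute])
qed

lemma little_group_mult: "little_group i (U ** V) f = little_group i U (little_group i V f)"
proof -
  have "(\<lambda>j. ((\<lambda>_. mat 1)(i := U)) j ** ((\<lambda>_. mat 1)(i := V)) j) =
      (\<lambda>_. mat 1 :: complex^2^2)(i := U ** V)"
    by auto
  then show ?thesis by (simp add: little_group_eq_gact gsubst_gact_compose)
qed

text \<open>The transformation law of \<open>spin_copy\<close> for a single matrix, stated without
  membership in \<open>SU2\<close> so that it can be extended to matrices of determinant 1.\<close>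

definition equivariant :: "2 \<Rightarrow> nat \<Rightarrow> (2 list \<Rightarrow> superfield) \<Rightarrow> complex ^ 2 ^ 2 \<Rightarrow> bool" where
  "equivariant i n \<phi> U \<longleftrightarrow> (\<forall>I. length I = n \<longrightarrow>
     little_group i U (\<phi> I) = (\<Sum>J | length J = n. (\<Prod>k<n. U $ (J ! k) $ (I ! k)) *\<^sub>G \<phi> J))"

text \<open>The left side of the law is multiplicative by \<open>little_group_mult\<close>, the
  right side because tensor powers of matrices multiply by \<open>sum_lists_prod\<close>.\<close>

lemma equivariant_mult:
  assumes U: "equivariant i n \<phi> U" and V: "equivariant i n \<phi> V"
  shows "equivariant i n \<phi> (U ** V)"
  unfolding equivariant_def
proof (intro allI impI)
  fix I :: "2 list"
  assume I: "length I = n"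
  have "little_group i (U ** V) (\<phi> I) = little_group i U (little_group i V (\<phi> I))"
    by (rule little_group_mult)
  also have "\<dots> = (\<Sum>J | length J = n. (\<Prod>k<n. V $ (J ! k) $ (I ! k)) *\<^sub>G little_group i U (\<phi> J))"
    using V I by (simp add: equivariant_def)
      (simp add: little_group_eq_gact gsubst_sum gsubst_scale)
  also have "\<dots> = (\<Sum>J | length J = n. \<Sum>K | length K = n.
      (\<Prod>k<n. U $ (K ! k) $ (J ! k) * V $ (J ! k) $ (I ! k)) *\<^sub>G \<phi> K)"
    using U by (intro sum.cong refl)
      (simp add: equivariant_def gscale_sum gscale_simps prod.distrib mult.commute)
  also have "\<dots> = (\<Sum>K | length K = n. \<Sum>J | length J = n.
      (\<Prod>k<n. U $ (K ! k) $ (J ! k) * V $ (J ! k) $ (I ! k)) *\<^sub>G \<phi> K)"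
    by (rule sum.swap)
  also have "\<dots> = (\<Sum>K | length K = n. (\<Prod>k<n. (U ** V) $ (K ! k) $ (I ! k)) *\<^sub>G \<phi> K)"
    using sum_lists_prod[where g = "\<lambda>k j. U $ (K ! k) $ j * V $ j $ (I ! k)" and n = n for K]
    by (simp add: gscale_sum_left[symmetric] matrix_matrix_mult_def)
  finally show "little_group i (U ** V) (\<phi> I) =
      (\<Sum>J | length J = n. (\<Prod>k<n. (U ** V) $ (J ! k) $ (I ! k)) *\<^sub>G \<phi> J)" .
qed

text \<open>The coefficients are polynomials in the entries of \<open>M t\<close>.\<close>

lemma holomorphic_little_group:
  assumes M: "\<And>a b. (\<lambda>t. M t $ a $ b) holomorphic_on A"
  shows "(\<lambda>t. gcoeff (little_group i (M t) f) S) holomorphic_on A"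
proof -
  let ?h = "\<lambda>t. gact ((\<lambda>_. mat 1)(i := M t))"
  have gen: "(\<lambda>t. gcoeff (?h t g) S) holomorphic_on A" for g S
  proof (cases g)
    case (Eta j I B)
    then show ?thesis by (cases "j = i") (auto simp: gact_def intro!: holomorphic_intros M)
  qed (simp add: gact_def)
  have "(\<lambda>t. gcoeff (prod_list (map (?h t) xs)) S) holomorphic_on A" for xs S
    by (induction xs arbitrary: S)
      (auto simp: gcoeff_one gcoeff_times intro!: holomorphic_intros gen)
  then show ?thesis
    unfolding little_group_eq_gact gsubst_def gcoeff_sum gcoeff_gscale
    by (intro holomorphic_intros)
qed

text \<open>For fixed \<open>I\<close> and \<open>S\<close> the difference of the two sides of the
  law is holomorphic in \<open>t\<close> and vanishes on \<open>T\<close>, so the identity theorem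
  applies.\<close>

lemma equivariant_continuation:
  assumes M: "\<And>a b. (\<lambda>t. M t $ a $ b) holomorphic_on A"
    and A: "open A" "connected A" "T \<subseteq> A" "\<xi> \<in> A" "\<xi> islimpt T"
    and T: "\<And>t. t \<in> T \<Longrightarrow> equivariant i n \<phi> (M t)"
    and w: "w \<in> A"
  shows "equivariant i n \<phi> (M w)"
  unfolding equivariant_def
proof (intro allI impI grassmann_eqI)
  fix I :: "2 list" and S
  assume I: "length I = n"
  let ?p = "\<lambda>t. gcoeff (little_group i (M t) (\<phi> I)) S -
    (\<Sum>J | length J = n. (\<Prod>k<n. M t $ (J ! k) $ (I ! k)) * gcoeff (\<phi> J) S)"
  have "?p holomorphic_on A"
    by (intro holomorphic_intros holomorphic_little_group M)
  moreover have "?p t = 0" if "t \<in> T" for t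
    using T[OF that] I by (simp add: equivariant_def)
  ultimately have "?p w = 0"
    using A w by (intro analytic_continuation[of ?p A T \<xi> w])
  then show "gcoeff (little_group i (M w) (\<phi> I)) S =
      gcoeff (\<Sum>J | length J = n. (\<Prod>k<n. M w $ (J ! k) $ (I ! k)) *\<^sub>G \<phi> J) S"
    by simp
qed

section \<open>From \<open>SU(2)\<close> to \<open>SL(2)\<close> by two by two matrices\<close>

definition mat2 :: "complex \<Rightarrow> complex \<Rightarrow> complex \<Rightarrow> complex \<Rightarrow> complex ^ 2 ^ 2" where
  "mat2 a b c d = (\<chi> i j. if i = 1 then if j = 1 then a else b else if j = 1 then c else d)"

lemma mat2_nth [simp]:
  "mat2 a b c d $ 1 $ 1 = a" "mat2 a b c d $ 1 $ 2 = b"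
  "mat2 a b c d $ 2 $ 1 = c" "mat2 a b c d $ 2 $ 2 = d"
  by (simp_all add: mat2_def)

lemma mat2_cases: obtains a b c d where "U = mat2 a b c d"
proof
  show "U = mat2 (U $ 1 $ 1) (U $ 1 $ 2) (U $ 2 $ 1) (U $ 2 $ 2)"
    by (simp add: vec_eq_iff forall_2)
qed

lemma mat2_mult:
  "mat2 a b c d ** mat2 a' b' c' d' =
   mat2 (a * a' + b * c') (a * b' + b * d') (c * a' + d * c') (c * b' + d * d')"
  by (simp add: vec_eq_iff forall_2 matrix_matrix_mult_def sum_2)

lemma det_mat2: "det (mat2 a b c d) = a * d - b * c"
  by (simp add: det_2)

lemma mat2_SU2:
  assumes "a * cnj a + b * cnj b = 1"
  shows "mat2 a b (- cnj b) (cnj a) \<in> SU2"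
  using assms by (simp add: SU2_def vec_eq_iff forall_2 matrix_matrix_mult_def sum_2 mat_def
      det_mat2 algebra_simps)

lemma equivariant_SU2: "spin_copy i (n, \<phi>) \<Longrightarrow> U \<in> SU2 \<Longrightarrow> equivariant i n \<phi> U"
  unfolding spin_copy_def equivariant_def split by blast

text \<open>For \<open>\<bar>q\<bar> = 1\<close> the matrix below lies in \<open>SU(2)\<close>; analytic continuation in \<open>q\<close> frees \<open>q\<close>, and
  letting \<open>t \<rightarrow> 0\<close> with \<open>t q\<close> fixed then produces the unipotent matrices.\<close>

lemma equivariant_rotation:
  assumes sc: "spin_copy i (n, \<phi>)" and q: "q \<noteq> 0"
  defines "r \<equiv> \<lambda>t::real. 1 + (of_real t)\<^sup>2 :: complex"
  shows "equivariant i n \<phi> (mat2 ((1 - (of_real t)\<^sup>2) / r t) (2 * of_real t * q / r t)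
      (- (2 * of_real t / q / r t)) ((1 - (of_real t)\<^sup>2) / r t))"
    (is "equivariant i n \<phi> (?M q)")
proof (rule equivariant_continuation[where M = ?M and A = "- {0}" and T = "sphere 0 1" and \<xi> = 1])
  have r: "r t = of_real (1 + t\<^sup>2)" by (simp add: r_def)
  have r0: "r t \<noteq> 0" unfolding r of_real_eq_0_iff
    using zero_le_power2[of t] by linarith
  have cr: "cnj (r t) = r t" by (simp add: r_def)
  show "(\<lambda>q. ?M q $ a $ b) holomorphic_on - {0}" for a b
    using exhaust_2[of a] exhaust_2[of b] r0 by (auto intro!: holomorphic_intros)
  show "connected (- {0 :: complex})"
    by (rule connected_punctured_universe) simp
  show "(1 :: complex) islimpt sphere 0 1"
  proof (rule connected_imp_perfect)
    have "(-1 :: complex) \<in> sphere 0 1" "(-1 :: complex) \<noteq> 1" by auto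
    then show "sphere (0 :: complex) 1 \<noteq> {a}" for a by (metis norm_one mem_sphere_0 singletonD)
  qed (auto intro: connected_sphere)
  show "equivariant i n \<phi> (?M q)" if "q \<in> sphere 0 1" for q
  proof -
    \<comment> \<open>On the unit circle \<open>cnj q = 1 / q\<close>, so the matrix, whose entries
      are holomorphic in \<open>q\<close>, takes there the form required by
      \<open>mat2_SU2\<close>.\<close>
    have "q * cnj q = 1" using that by (simp add: complex_norm_square[symmetric])
    moreover from this have q0: "q \<noteq> 0" by auto
    ultimately have cq: "cnj q = 1 / q" by (metis nonzero_mult_div_cancel_left)
    have e1: "X / R * (X / R) + Y * q / R * (Y * (1 / q) / R) = (X\<^sup>2 + Y\<^sup>2) / R\<^sup>2" for X Y R :: complex
      using q0 by (simp add: power2_eq_square add_divide_distrib)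
    \<comment> \<open>Divided by \<open>r t\<close>, the two bases are the rational parametrization
      of cosine and sine; this identity says that their squares add up to 1.\<close>
    have e2: "(1 - (complex_of_real t)\<^sup>2)\<^sup>2 + (2 * of_real t)\<^sup>2 = (r t)\<^sup>2"
      by (simp add: r_def power2_eq_square algebra_simps)
    have "(1 - (of_real t)\<^sup>2) / r t * ((1 - (of_real t)\<^sup>2) / r t) +
        2 * of_real t * q / r t * (2 * of_real t * (1 / q) / r t) = 1"
      unfolding e1 e2 using r0 by simp
    then have "mat2 ((1 - (of_real t)\<^sup>2) / r t) (2 * of_real t * q / r t)
       (- cnj (2 * of_real t * q / r t)) (cnj ((1 - (of_real t)\<^sup>2) / r t)) \<in> SU2"
      by (intro mat2_SU2) (simp add: cq cr)
    then show ?thesis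
      by (intro equivariant_SU2[OF sc]) (simp add: cq cr)
  qed
qed (use q in \<open>auto simp: open_Compl\<close>)

text \<open>The choice \<open>q = s / (2 * t)\<close> in the preceding family keeps the upper right
  numerator equal to \<open>s\<close>. All entries are then holomorphic at \<open>t = 0\<close>,
  where the matrix becomes unipotent, and the real points of the unit interval accumulate there. The
  case \<open>s = 0\<close> is separate because it would force \<open>q = 0\<close>.\<close>

lemma equivariant_upper:
  assumes sc: "spin_copy i (n, \<phi>)"
  shows "equivariant i n \<phi> (mat2 1 s 0 1)"
proof (cases "s = 0")
  case True
  have "mat2 1 0 (- cnj 0) (cnj 1) \<in> SU2" by (rule mat2_SU2) simp
  then show ?thesis using True equivariant_SU2[OF sc] by simp
next
  case False
  let ?M = "\<lambda>t. mat2 ((1 - t\<^sup>2) / (1 + t\<^sup>2)) (s / (1 + t\<^sup>2))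
    (- (4 * t\<^sup>2 / s / (1 + t\<^sup>2))) ((1 - t\<^sup>2) / (1 + t\<^sup>2))"
  have "equivariant i n \<phi> (?M 0)"
  proof (rule equivariant_continuation[where M = ?M and A = "ball 0 1" and \<xi> = 0 and
        T = "complex_of_real ` {0<..<1}"])
    \<comment> \<open>The poles of the entries are the two square roots of -1, which have modulus 1;
      hence the unit disc as domain.\<close>
    have r0: "1 + t\<^sup>2 \<noteq> 0" if "t \<in> ball 0 1" for t :: complex
    proof
      assume "1 + t\<^sup>2 = 0"
      then have "t\<^sup>2 = -1" by (simp add: add_eq_0_iff)
      then have "(cmod t)\<^sup>2 = 1" by (simp flip: norm_power)
      then show False using that by (simp add: abs_square_eq_1)
    qed
    show "(\<lambda>q. ?M q $ a $ b) holomorphic_on ball 0 1" for a b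
      using exhaust_2[of a] exhaust_2[of b] r0 False by (auto intro!: holomorphic_intros)
    show "(0 :: complex) islimpt complex_of_real ` {0<..<1}"
      unfolding islimpt_approachable
    proof (intro allI impI)
      fix e :: real assume "e > 0"
      then show "\<exists>x'\<in>complex_of_real ` {0<..<1}. x' \<noteq> 0 \<and> dist x' 0 < e"
        by (intro bexI[of _ "complex_of_real (min (e/2) (1/2))"]) (auto simp: min_def)
    qed
    show "equivariant i n \<phi> (?M t)" if tT: "t \<in> complex_of_real ` {0<..<1}" for t
    proof -
      obtain t' where t: "t = of_real t'" "0 < t'" "t' < 1" using tT by auto
      define q where "q = s / (2 * t)"
      have q: "q \<noteq> 0" "2 * t * q = s" "2 * t / q = 4 * t\<^sup>2 / s"
        using False t by (simp_all add: q_def power2_eq_square)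
      show ?thesis
        using equivariant_rotation[OF sc q(1), of t'] unfolding t(1)[symmetric] q(2,3) .
    qed
  next
    show "complex_of_real ` {0<..<1} \<subseteq> ball 0 1" by auto
  qed simp_all
  then show ?thesis by simp
qed

text \<open>Conjugation by the quarter turn, an element of \<open>SU2\<close>, exchanges upper and
  lower unipotent matrices.\<close>

lemma equivariant_lower:
  assumes sc: "spin_copy i (n, \<phi>)"
  shows "equivariant i n \<phi> (mat2 1 0 s 1)"
proof -
  have "mat2 0 1 (- cnj 1) (cnj 0) \<in> SU2" "mat2 0 (-1) (- cnj (-1)) (cnj 0) \<in> SU2"
    by (rule mat2_SU2; simp)+
  then have "equivariant i n \<phi> (mat2 0 1 (-1) 0)" "equivariant i n \<phi> (mat2 0 (-1) 1 0)"
    using equivariant_SU2[OF sc] by auto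
  then have "equivariant i n \<phi> (mat2 0 (-1) 1 0 ** (mat2 1 (-s) 0 1 ** mat2 0 1 (-1) 0))"
    by (intro equivariant_mult equivariant_upper sc)
  then show ?thesis by (simp add: mat2_mult)
qed

text \<open>Unipotent matrices generate the group: if the lower left entry is non-zero, the matrix
  factors explicitly as upper times lower times upper.\<close>

lemma equivariant_SL2:
  assumes sc: "spin_copy i (n, \<phi>)" and det: "det U = 1"
  shows "equivariant i n \<phi> U"
proof -
  have gen: "equivariant i n \<phi> (mat2 a b c d)" if "a * d - b * c = 1" "c \<noteq> 0" for a b c d
  proof -
    have "equivariant i n \<phi> (mat2 1 ((a - 1) / c) 0 1 ** (mat2 1 0 c 1 ** mat2 1 ((d - 1) / c) 0 1))"
      by (intro equivariant_mult equivariant_upper equivariant_lower sc)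
    moreover have "mat2 1 ((a - 1) / c) 0 1 ** (mat2 1 0 c 1 ** mat2 1 ((d - 1) / c) 0 1) =
        mat2 a b c d"
      using that by (simp add: mat2_mult vec_eq_iff forall_2) (simp add: field_simps)
    ultimately show ?thesis by simp
  qed
  obtain a b c d where U: "U = mat2 a b c d" by (rule mat2_cases)
  have abcd: "a * d - b * c = 1" using det by (simp add: U det_mat2)
  show ?thesis
  proof (cases "c = 0")
    case True
    \<comment> \<open>Adding the first row to the second makes the lower left entry
      \<open>a\<close>, which is non-zero because \<open>a * d = 1\<close>; the left factor undoes
      this row operation.\<close>
    have "equivariant i n \<phi> (mat2 1 0 (-1) 1 ** mat2 a b a (b + d))"
      using abcd True by (intro equivariant_mult equivariant_lower sc gen) (auto simp: algebra_simps)
    then show ?thesis using True by (simp add: U mat2_mult)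
  qed (use gen abcd U in simp)
qed

section \<open>Symmetric tensors as binary forms\<close>

lemma sum_permute_list:
  fixes g :: "'a::finite list \<Rightarrow> 'b::comm_monoid_add"
  assumes p: "p permutes {..<n}"
  shows "(\<Sum>I | length I = n. g (permute_list p I)) = (\<Sum>I | length I = n. g I)"
proof (rule sum.reindex_bij_witness[where i = "permute_list (inv p)" and j = "permute_list p"])
  fix I :: "'a list" assume "I \<in> {I. length I = n}"
  then have "p permutes {..<length I}" "inv p permutes {..<length I}"
    using p permutes_inv by auto
  then show "permute_list (inv p) (permute_list p I) = I" "permute_list p (permute_list (inv p) I) = I"
    by (simp_all flip: permute_list_compose add: permutes_inv_o permute_list_id)
qed auto

lemma prod_permute_list:
  fixes g :: "'a \<Rightarrow> 'b::comm_monoid_mult"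
  assumes p: "p permutes {..<n}" and I: "length I = n"
  shows "(\<Prod>k<n. g (permute_list p I ! k)) = (\<Prod>k<n. g (I ! k))"
proof -
  have "(\<Prod>k<n. g (permute_list p I ! k)) = (\<Prod>k<n. g (I ! p k))"
    using p I by (intro prod.cong) (auto simp: permute_list_nth)
  also have "\<dots> = (\<Prod>k<n. g (I ! k))"
    using prod.permute[OF p, of "\<lambda>k. g (I ! k)"] by (simp add: o_def)
  finally show ?thesis .
qed

text \<open>Applying one matrix to every slot preserves symmetry: the permutation relating
  \<open>K\<close> and \<open>K'\<close> is moved to the summation index, where \<open>T\<close>
  absorbs it.\<close>

lemma transform_symmetric:
  fixes T :: "'a::finite list \<Rightarrow> complex"
  assumes T: "\<And>I J. mset I = mset J \<Longrightarrow> T I = T J" and K: "mset K = mset K'" "length K = n"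
  shows "(\<Sum>I | length I = n. T I * (\<Prod>k<n. M (K ! k) (I ! k))) =
         (\<Sum>I | length I = n. T I * (\<Prod>k<n. M (K' ! k) (I ! k)))"
proof -
  have K': "length K' = n" using K by (metis size_mset)
  obtain p where p: "p permutes {..<n}" "permute_list p K' = K"
    using mset_eq_permutation[OF K(1)] K' by metis
  have "(\<Sum>I | length I = n. T I * (\<Prod>k<n. M (K ! k) (I ! k))) =
      (\<Sum>I | length I = n. T (permute_list p I) * (\<Prod>k<n. M (K ! k) (permute_list p I ! k)))"
    using sum_permute_list[OF p(1), of "\<lambda>I. T I * (\<Prod>k<n. M (K ! k) (I ! k))"] by simp
  also have "\<dots> = (\<Sum>I | length I = n. T I * (\<Prod>k<n. M (K' ! k) (I ! k)))"
  proof (rule sum.cong[OF refl])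
    fix I :: "'a list" assume I: "I \<in> {I. length I = n}"
    have "(\<Prod>k<n. M (K ! k) (permute_list p I ! k)) = (\<Prod>k<n. M (K' ! p k) (I ! p k))"
      using p I K' by (intro prod.cong) (auto simp: permute_list_nth)
    also have "\<dots> = (\<Prod>k<n. M (K' ! k) (I ! k))"
      using prod.permute[OF p(1), of "\<lambda>k. M (K' ! k) (I ! k)"] by (simp add: o_def)
    finally show "T (permute_list p I) * (\<Prod>k<n. M (K ! k) (permute_list p I ! k)) =
        T I * (\<Prod>k<n. M (K' ! k) (I ! k))"
      using T[of "permute_list p I" I] p I by simp
  qed
  finally show ?thesis .
qed

section \<open>Recovering a symmetric tensor from an affine chart\<close>

definition vec2 :: "complex \<Rightarrow> complex \<Rightarrow> 2 \<Rightarrow> complex" where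
  "vec2 a b i = (if i = 1 then a else b)"

lemma vec2_simps [simp]: "vec2 a b 1 = a" "vec2 a b 2 = b"
  by (simp_all add: vec2_def)

lemma count_1_2: "count (mset I) 1 + count (mset I) 2 = length (I :: 2 list)"
proof (induction I)
  case (Cons i I)
  then show ?case using exhaust_2[of i] by auto
qed simp

lemma mset_eq_if_count_2:
  fixes I J :: "2 list"
  assumes "length I = length J" "count (mset I) 2 = count (mset J) 2"
  shows "mset I = mset J"
proof (rule multiset_eqI)
  fix i :: 2
  show "count (mset I) i = count (mset J) i"
    using exhaust_2[of i] assms count_1_2[of I] count_1_2[of J] by auto
qed

lemma prod_vec2: "length I = n \<Longrightarrow> (\<Prod>k<n. vec2 1 y (I ! k)) = y ^ count (mset I) 2"
proof (induction I arbitrary: n)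
  case (Cons i I)
  then show ?case using exhaust_2[of i]
    by (auto simp: prod.lessThan_Suc_shift simp del: prod.lessThan_Suc)
qed simp

text \<open>At \<open>vec2 1 y\<close> the form is a polynomial in \<open>y\<close> whose
  coefficient \<open>c j\<close> sums \<open>T\<close> over the lists with \<open>j\<close> entries
  equal to 2. Infinitely many roots kill all coefficients. By symmetry the summands of each
  \<open>c j\<close> are equal, so \<open>c j\<close> is a positive integer times their common
  value.\<close>

lemma symmetric_tensor_eq_0:
  fixes T :: "2 list \<Rightarrow> complex"
  assumes T: "\<And>I J. mset I = mset J \<Longrightarrow> T I = T J"
    and Y: "infinite Y"
    and zero: "\<And>y. y \<in> Y \<Longrightarrow> (\<Sum>I | length I = n. T I * (\<Prod>k<n. vec2 1 y (I ! k))) = 0"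
    and I: "length I = n"
  shows "T I = 0"
proof -
  define c where "c j = (\<Sum>I | length I = n \<and> count (mset I) 2 = j. T I)" for j
  have "(\<Sum>j\<le>n. c j * y ^ j) = 0" if "y \<in> Y" for y
  proof -
    have "(\<Sum>j\<le>n. c j * y ^ j) =
        (\<Sum>j\<le>n. \<Sum>I | I \<in> {I. length I = n} \<and> count (mset I) 2 = j. T I * y ^ count (mset I) 2)"
      unfolding c_def by (simp add: sum_distrib_right)
    also have "\<dots> = (\<Sum>I | length I = n. T I * y ^ count (mset I) 2)"
    proof (rule sum.group)
      have "count (mset I) 2 \<le> length I" for I :: "2 list" using count_1_2[of I] by linarith
      then show "(\<lambda>I. count (mset I) 2) ` {I :: 2 list. length I = n} \<subseteq> {..n}" by auto
    qed simp_all
    also have "\<dots> = (\<Sum>I | length I = n. T I * (\<Prod>k<n. vec2 1 y (I ! k)))"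
      by (intro sum.cong refl) (simp add: prod_vec2)
    finally show ?thesis using zero[OF that] by simp
  qed
  then have "Y \<subseteq> {y. (\<Sum>j\<le>n. c j * y ^ j) = 0}" by blast
  with Y have "infinite {y. (\<Sum>j\<le>n. c j * y ^ j) = 0}" using finite_subset by blast
  then have c: "c j = 0" if "j \<le> n" for j using that polyfun_finite_roots by blast
  define X where "X = {J :: 2 list. length J = n \<and> count (mset J) 2 = count (mset I) 2}"
  have "finite X" unfolding X_def by (rule finite_subset[OF _ finite_lists_length[of n]]) auto
  moreover have "I \<in> X" using I by (simp add: X_def)
  ultimately have X: "card X \<noteq> 0" by auto
  have "T J = T I" if "J \<in> X" for J
    using that I by (intro T mset_eq_if_count_2) (auto simp: X_def)
  then have "c (count (mset I) 2) = of_nat (card X) * T I" by (simp add: c_def flip: X_def)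
  moreover have "count (mset I) 2 \<le> n" using count_1_2[of I] I by simp
  ultimately show ?thesis using c X by simp
qed

definition bitensor_form ::
  "nat \<Rightarrow> nat \<Rightarrow> (2 list \<Rightarrow> 2 list \<Rightarrow> complex) \<Rightarrow> (2 \<Rightarrow> complex) \<Rightarrow> (2 \<Rightarrow> complex) \<Rightarrow> complex" where
  "bitensor_form n n' C u v = (\<Sum>I | length I = n. \<Sum>J | length J = n'.
     C I J * (\<Prod>k<n. u (I ! k)) * (\<Prod>k<n'. v (J ! k)))"

lemma bitensor_form_scale:
  "bitensor_form n n' C (\<lambda>i. t * u i) v = t ^ n * bitensor_form n n' C u v"
  "bitensor_form n n' C u (\<lambda>i. t * v i) = t ^ n' * bitensor_form n n' C u v"
  by (simp_all add: bitensor_form_def sum_distrib_left prod.distrib mult_ac)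

text \<open>For fixed \<open>z\<close> the tensor in \<open>J\<close> obtained by contracting
  \<open>I\<close> with \<open>vec2 1 z\<close> vanishes; varying \<open>z\<close> then removes the
  contraction. Infinitely many \<open>y\<close> for each \<open>z\<close> suffice, so degenerate
  pairs of vectors can be avoided.\<close>

lemma bitensor_form_eq_0:
  assumes C: "\<And>I I' J J'. mset I = mset I' \<Longrightarrow> mset J = mset J' \<Longrightarrow> C I J = C I' J'"
    and zero: "\<And>z. infinite {y. bitensor_form n n' C (vec2 1 z) (vec2 1 y) = 0}"
    and IJ: "length I = n" "length J = n'"
  shows "C I J = 0"
proof (rule symmetric_tensor_eq_0[where T = "\<lambda>I. C I J" and Y = UNIV])
  fix z :: complex
  show "(\<Sum>I | length I = n. C I J * (\<Prod>k<n. vec2 1 z (I ! k))) = 0"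
  proof (rule symmetric_tensor_eq_0[OF _ zero[of z]])
    fix y
    assume "y \<in> {y. bitensor_form n n' C (vec2 1 z) (vec2 1 y) = 0}"
    then show "(\<Sum>J | length J = n'. (\<Sum>I | length I = n. C I J * (\<Prod>k<n. vec2 1 z (I ! k))) *
        (\<Prod>k<n'. vec2 1 y (J ! k))) = 0"
      unfolding bitensor_form_def by (subst (asm) sum.swap) (simp add: sum_distrib_right)
  next
    show "(\<Sum>I | length I = n. C I J * (\<Prod>k<n. vec2 1 z (I ! k))) =
        (\<Sum>I | length I = n. C I J' * (\<Prod>k<n. vec2 1 z (I ! k)))" if "mset J = mset J'" for J J'
      using C[OF refl that] by (simp only:)
  qed (fact IJ)
next
  show "C I J = C I' J" if "mset I = mset I'" for I I'
    using C[OF that refl] .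
qed (simp_all add: IJ infinite_UNIV_char_0)

text \<open>The permutations relating the lists are absorbed into the summation variables.\<close>

lemma sym_power_cong:
  assumes "mset I = mset I'" "mset J = mset J'" "length I = n" "length J = n"
  shows "sym_power B n I J = sym_power B n I' J'"
proof -
  have len: "length I' = n" "length J' = n" using assms by (metis size_mset)+
  obtain p where p: "p permutes {..<n}" "permute_list p I' = I"
    using mset_eq_permutation[OF assms(1)] len by metis
  obtain q where q: "q permutes {..<n}" "permute_list q J' = J"
    using mset_eq_permutation[OF assms(2)] len by metis
  let ?P = "{\<pi>. \<pi> permutes {..<n}}"
  have reindex: "(\<Sum>\<pi>\<in>?P. g (r \<circ> \<pi>)) = (\<Sum>\<pi>\<in>?P. g \<pi>)" if "r permutes {..<n}"
    for r and g :: "(nat \<Rightarrow> nat) \<Rightarrow> complex"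
    using setum_permutations_compose_left[OF that, of g] by simp
  have "(\<Sum>\<pi>\<in>?P. \<Sum>\<tau>\<in>?P. \<Prod>k<n. B (I ! \<pi> k) (J ! \<tau> k)) =
      (\<Sum>\<pi>\<in>?P. \<Sum>\<tau>\<in>?P. \<Prod>k<n. B (I' ! (p \<circ> \<pi>) k) (J' ! (q \<circ> \<tau>) k))"
  proof (intro sum.cong prod.cong refl)
    fix \<pi> \<tau> k assume "\<pi> \<in> ?P" "\<tau> \<in> ?P" "k \<in> {..<n}"
    then have "\<pi> k < n" "\<tau> k < n" using permutes_in_image by fastforce+
    then show "B (I ! \<pi> k) (J ! \<tau> k) = B (I' ! (p \<circ> \<pi>) k) (J' ! (q \<circ> \<tau>) k)"
      using p q len by (metis comp_apply permute_list_nth)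
  qed
  also have "\<dots> = (\<Sum>\<pi>\<in>?P. \<Sum>\<tau>\<in>?P. \<Prod>k<n. B (I' ! \<pi> k) (J' ! (q \<circ> \<tau>) k))"
    by (rule reindex[OF p(1), of "\<lambda>\<pi>. \<Sum>\<tau>\<in>?P. \<Prod>k<n. B (I' ! \<pi> k) (J' ! (q \<circ> \<tau>) k)"])
  also have "\<dots> = (\<Sum>\<pi>\<in>?P. \<Sum>\<tau>\<in>?P. \<Prod>k<n. B (I' ! \<pi> k) (J' ! \<tau> k))"
    by (rule sum.cong[OF refl],
        rule reindex[OF q(1), of "\<lambda>\<tau>. \<Prod>k<n. B (I' ! \<pi> k) (J' ! \<tau> k)" for \<pi>])
  finally show ?thesis by (simp add: sym_power_def)
qed

text \<open>Relabelling \<open>I\<close> and \<open>J\<close> shows that every pair of permutations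
  contributes equally; the contribution factors slot by slot into a power, and the number of pairs
  cancels the normalization.\<close>

lemma bitensor_form_sym_power:
  "bitensor_form n n (sym_power B n) u v = (\<Sum>i\<in>UNIV. \<Sum>j\<in>UNIV. B i j * u i * v j) ^ n"
proof -
  let ?P = "{\<pi>. \<pi> permutes {..<n}}"
  let ?b = "\<Sum>i\<in>UNIV. \<Sum>j\<in>UNIV. B i j * u i * v j"
  let ?L = "{I :: 2 list. length I = n}"
  have one: "(\<Sum>I\<in>?L. \<Sum>J\<in>?L. (\<Prod>k<n. B (I ! \<pi> k) (J ! \<tau> k)) *
      (\<Prod>k<n. u (I ! k)) * (\<Prod>k<n. v (J ! k))) = ?b ^ n" if pt: "\<pi> \<in> ?P" "\<tau> \<in> ?P" for \<pi> \<tau>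
  proof -
    have "(\<Sum>I\<in>?L. \<Sum>J\<in>?L. (\<Prod>k<n. B (I ! \<pi> k) (J ! \<tau> k)) *
        (\<Prod>k<n. u (I ! k)) * (\<Prod>k<n. v (J ! k))) =
      (\<Sum>I\<in>?L. \<Sum>J\<in>?L. (\<Prod>k<n. B (permute_list \<pi> I ! k) (permute_list \<tau> J ! k)) *
        (\<Prod>k<n. u (permute_list \<pi> I ! k)) * (\<Prod>k<n. v (permute_list \<tau> J ! k)))"
    proof (intro sum.cong refl)
      fix I J assume "I \<in> ?L" "J \<in> ?L"
      then show "(\<Prod>k<n. B (I ! \<pi> k) (J ! \<tau> k)) * (\<Prod>k<n. u (I ! k)) * (\<Prod>k<n. v (J ! k)) =
          (\<Prod>k<n. B (permute_list \<pi> I ! k) (permute_list \<tau> J ! k)) *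
          (\<Prod>k<n. u (permute_list \<pi> I ! k)) * (\<Prod>k<n. v (permute_list \<tau> J ! k))"
        using pt prod_permute_list[of \<pi> n I u] prod_permute_list[of \<tau> n J v]
        by (simp add: permute_list_nth)
    qed
    also have "\<dots> = (\<Sum>I\<in>?L. \<Sum>J\<in>?L. (\<Prod>k<n. B (permute_list \<pi> I ! k) (J ! k)) *
        (\<Prod>k<n. u (permute_list \<pi> I ! k)) * (\<Prod>k<n. v (J ! k)))"
      using pt by (rule_tac sum.cong[OF refl])
        (simp only: mem_Collect_eq sum_permute_list[where p = \<tau> and g = "\<lambda>J. (\<Prod>k<n. B (permute_list \<pi> I ! k) (J ! k)) *
        (\<Prod>k<n. u (permute_list \<pi> I ! k)) * (\<Prod>k<n. v (J ! k))" for I])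
    also have "\<dots> = (\<Sum>I\<in>?L. \<Sum>J\<in>?L. (\<Prod>k<n. B (I ! k) (J ! k)) *
        (\<Prod>k<n. u (I ! k)) * (\<Prod>k<n. v (J ! k)))"
      using pt by (simp only: mem_Collect_eq sum_permute_list[where p = \<pi> and g = "\<lambda>I. \<Sum>J\<in>?L. (\<Prod>k<n. B (I ! k) (J ! k)) *
        (\<Prod>k<n. u (I ! k)) * (\<Prod>k<n. v (J ! k))"])
    also have "\<dots> = (\<Sum>I\<in>?L. \<Sum>J\<in>?L. \<Prod>k<n. B (I ! k) (J ! k) * u (I ! k) * v (J ! k))"
      by (simp add: prod.distrib)
    also have "\<dots> = (\<Sum>I\<in>?L. \<Prod>k<n. \<Sum>j\<in>UNIV. B (I ! k) j * u (I ! k) * v j)"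
      by (simp add: sum_lists_prod[where g = "\<lambda>k j. B (I ! k) j * u (I ! k) * v j" for I])
    also have "\<dots> = (\<Prod>k<n. ?b)"
      by (rule sum_lists_prod[where g = "\<lambda>k i. \<Sum>j\<in>UNIV. B i j * u i * v j"])
    finally show ?thesis by simp
  qed
  have "bitensor_form n n (sym_power B n) u v =
      (\<Sum>I\<in>?L. \<Sum>J\<in>?L. \<Sum>\<pi>\<in>?P. \<Sum>\<tau>\<in>?P. (\<Prod>k<n. B (I ! \<pi> k) (J ! \<tau> k)) *
      (\<Prod>k<n. u (I ! k)) * (\<Prod>k<n. v (J ! k))) / fact n ^ 2"
    by (simp add: bitensor_form_def sym_power_def sum_distrib_right sum_divide_distrib)
  also have "(\<Sum>I\<in>?L. \<Sum>J\<in>?L. \<Sum>\<pi>\<in>?P. \<Sum>\<tau>\<in>?P. (\<Prod>k<n. B (I ! \<pi> k) (J ! \<tau> k)) *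
      (\<Prod>k<n. u (I ! k)) * (\<Prod>k<n. v (J ! k))) =
      (\<Sum>I\<in>?L. \<Sum>\<pi>\<in>?P. \<Sum>J\<in>?L. \<Sum>\<tau>\<in>?P. (\<Prod>k<n. B (I ! \<pi> k) (J ! \<tau> k)) *
      (\<Prod>k<n. u (I ! k)) * (\<Prod>k<n. v (J ! k)))"
    by (intro sum.cong refl) (rule sum.swap)
  also have "\<dots> = (\<Sum>\<pi>\<in>?P. \<Sum>I\<in>?L. \<Sum>\<tau>\<in>?P. \<Sum>J\<in>?L. (\<Prod>k<n. B (I ! \<pi> k) (J ! \<tau> k)) *
      (\<Prod>k<n. u (I ! k)) * (\<Prod>k<n. v (J ! k)))"
    by (subst sum.swap) (intro sum.cong refl, rule sum.swap)
  also have "\<dots> = (\<Sum>\<pi>\<in>?P. \<Sum>\<tau>\<in>?P. \<Sum>I\<in>?L. \<Sum>J\<in>?L. (\<Prod>k<n. B (I ! \<pi> k) (J ! \<tau> k)) *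
      (\<Prod>k<n. u (I ! k)) * (\<Prod>k<n. v (J ! k)))"
    by (intro sum.cong refl) (rule sum.swap)
  also have "\<dots> = (\<Sum>\<pi>\<in>?P. \<Sum>\<tau>\<in>?P. ?b ^ n)"
    by (intro sum.cong refl) (rule one)
  also have "\<dots> = fact n ^ 2 * ?b ^ n"
    by (simp add: card_permutations[OF refl] power2_eq_square)
  finally show ?thesis by simp
qed

section \<open>Components and invariance\<close>

definition leg_gens :: "2 \<Rightarrow> gen set" where
  "leg_gens i = {Eta i I A | I A. True}"

lemma sum_swap_pairs:
  "(\<Sum>a\<in>A. \<Sum>b\<in>B. \<Sum>c\<in>C. \<Sum>d\<in>D. h a b c d) = (\<Sum>c\<in>C. \<Sum>d\<in>D. \<Sum>a\<in>A. \<Sum>b\<in>B. h a b c d)"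
proof -
  have "(\<Sum>a\<in>A. \<Sum>b\<in>B. \<Sum>c\<in>C. \<Sum>d\<in>D. h a b c d) =
      (\<Sum>a\<in>A. \<Sum>c\<in>C. \<Sum>d\<in>D. \<Sum>b\<in>B. h a b c d)"
    by (rule sum.cong[OF refl], subst sum.swap, rule sum.cong[OF refl], rule sum.swap)
  also have "\<dots> = (\<Sum>c\<in>C. \<Sum>d\<in>D. \<Sum>a\<in>A. \<Sum>b\<in>B. h a b c d)"
    by (subst sum.swap, rule sum.cong[OF refl], rule sum.swap)
  finally show ?thesis .
qed

lemma leg_algebra_iff: "f \<in> leg_algebra i \<longleftrightarrow> (\<forall>S. gcoeff f S \<noteq> 0 \<longrightarrow> S \<subseteq> leg_gens i)"
  by (simp add: leg_algebra_def leg_gens_def)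

text \<open>All generators of leg 1 precede those of leg 2, so no sign arises, and only one
  splitting of the union is compatible with the legs. The product is thus that of a tensor
  product.\<close>

lemma gcoeff_leg_mult:
  assumes "f \<in> leg_algebra 1" "g \<in> leg_algebra 2" "S \<subseteq> leg_gens 1" "T \<subseteq> leg_gens 2"
  shows "gcoeff (f * g) (S \<union> T) = gcoeff f S * gcoeff g T"
proof -
  have disj: "leg_gens 1 \<inter> leg_gens 2 = {}" by (auto simp: leg_gens_def)
  have "\<not> t < s" if st: "s \<in> leg_gens 1" "t \<in> leg_gens 2" for s t
  proof -
    obtain I A where s: "s = Eta 1 I A" using st by (auto simp: leg_gens_def)
    obtain J B where t: "t = Eta 2 J B" using st by (auto simp: leg_gens_def)
    show ?thesis
      using num_less(1)[of I] num_less(2)[of A] by (simp add: s t less_gen_def num2_def)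
  qed
  then have "{(s, t). s \<in> S \<and> t \<in> T \<and> t < s} = {}" using assms by blast
  then have sgn: "gsign S T = 1" by (simp only: gsign_def inversions_def card.empty power_0)
  have "gcoeff (f * g) (S \<union> T) =
      (\<Sum>R\<in>Pow (S \<union> T). if R = S then gcoeff f S * gcoeff g T else 0)"
    unfolding gcoeff_times
  proof (rule sum.cong[OF refl])
    fix R assume R: "R \<in> Pow (S \<union> T)"
    have ST: "S \<union> T - S = T" using assms disj by blast
    show "gsign R (S \<union> T - R) * gcoeff f R * gcoeff g (S \<union> T - R) =
        (if R = S then gcoeff f S * gcoeff g T else 0)"
    proof (cases "gcoeff f R \<noteq> 0 \<and> gcoeff g (S \<union> T - R) \<noteq> 0")
      case True
      then have "R \<subseteq> leg_gens 1" "S \<union> T - R \<subseteq> leg_gens 2"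
        using assms(1,2) by (auto simp: leg_algebra_iff)
      then have "R = S" using R assms disj by blast
      then show ?thesis by (simp add: ST sgn)
    qed (auto simp: ST)
  qed
  then show ?thesis by simp
qed

text \<open>Linear independence, obtained from the uniqueness clause for the zero element by
  comparison with zero coefficients.\<close>

lemma decomposition_independent:
  assumes D: "little_group_decomposition i D"
    and c: "\<And>k I J. k < length D \<Longrightarrow> length I = fst (D ! k) \<Longrightarrow> mset I = mset J \<Longrightarrow> c k I = c k J"
    and zero: "(\<Sum>k<length D. \<Sum>I | length I = fst (D ! k). c k I *\<^sub>G snd (D ! k) I) = 0"
    and kI: "k < length D" "length I = fst (D ! k)"
  shows "c k I = 0"
proof -
  define P where "P c \<longleftrightarrow>
     (\<forall>k I. \<not> (k < length D \<and> length I = fst (D ! k)) \<longrightarrow> c k I = 0) \<and>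
     (\<forall>k I J. mset I = mset J \<longrightarrow> c k I = c k J) \<and>
     0 = (\<Sum>k<length D. \<Sum>I | length I = fst (D ! k). c k I *\<^sub>G snd (D ! k) I)"
    for c :: "nat \<Rightarrow> 2 list \<Rightarrow> complex"
  \<comment> \<open>The uniqueness clause speaks of coefficients that vanish outside the relevant
    lengths. Cutting off preserves symmetry, since lists with equal multisets have equal
    length.\<close>
  define c' where "c' k I = (if k < length D \<and> length I = fst (D ! k) then c k I else 0)" for k I
  have "(0 :: superfield) \<in> leg_algebra i" by (simp add: leg_algebra_def)
  then have ex1: "\<exists>!c. P c"
    using D unfolding little_group_decomposition_def P_def by blast
  have "P c'"
    unfolding P_def
  proof (intro conjI allI impI)
    show "c' k I = 0" if "\<not> (k < length D \<and> length I = fst (D ! k))" for k I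
      using that by (auto simp: c'_def)
    show "c' k I = c' k J" if "mset I = mset J" for k I J
      using c[of k I J] mset_eq_length[OF that] that by (auto simp: c'_def)
    have "(\<Sum>k<length D. \<Sum>I | length I = fst (D ! k). c' k I *\<^sub>G snd (D ! k) I) =
        (\<Sum>k<length D. \<Sum>I | length I = fst (D ! k). c k I *\<^sub>G snd (D ! k) I)"
      by (intro sum.cong refl) (simp add: c'_def)
    then show "0 = (\<Sum>k<length D. \<Sum>I | length I = fst (D ! k). c' k I *\<^sub>G snd (D ! k) I)"
      by (simp only: zero)
  qed
  moreover have "P (\<lambda>_ _. 0)" by (simp add: P_def gscale_simps)
  ultimately have "c' = (\<lambda>_ _. 0)" using ex1 by blast
  then have "c' k I = 0" by simp
  then show ?thesis using kI by (simp add: c'_def)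
qed

lemma decomposition_leg_algebra:
  assumes "little_group_decomposition i D" "k < length D" "length I = fst (D ! k)"
  shows "snd (D ! k) I \<in> leg_algebra i"
proof -
  have "spin_copy i (D ! k)"
    using assms by (auto simp: little_group_decomposition_def)
  then show ?thesis using assms(3) unfolding spin_copy_def case_prod_beta by blast
qed

lemma decomposition_equivariant:
  assumes "little_group_decomposition i D" "k < length D" "det U = 1"
  shows "equivariant i (fst (D ! k)) (snd (D ! k)) U"
proof -
  have "spin_copy i (D ! k)"
    using assms by (auto simp: little_group_decomposition_def)
  then show ?thesis using equivariant_SL2[of i "fst (D ! k)" "snd (D ! k)"] assms(3) by simp
qed

text \<open>The products of states of the two legs are independent as in a tensor product: taking
  the coefficient of a monomial of leg 2 leaves a relation on leg 1, and its vanishing coefficients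
  give a relation on leg 2.\<close>

lemma component_amplitudes_independent:
  assumes D1: "little_group_decomposition 1 D1" and D2: "little_group_decomposition 2 D2"
    and C: "\<And>k l I I' J J'. k < length D1 \<Longrightarrow> l < length D2 \<Longrightarrow>
      length I = fst (D1 ! k) \<Longrightarrow> length J = fst (D2 ! l) \<Longrightarrow>
      mset I = mset I' \<Longrightarrow> mset J = mset J' \<Longrightarrow> C k l I J = C k l I' J'"
    and zero: "(\<Sum>k<length D1. \<Sum>l<length D2.
            \<Sum>I | length I = fst (D1 ! k). \<Sum>J | length J = fst (D2 ! l).
              C k l I J *\<^sub>G (snd (D1 ! k) I * snd (D2 ! l) J)) = 0"
    and kI: "k < length D1" "length I = fst (D1 ! k)"
    and lJ: "l < length D2" "length J = fst (D2 ! l)"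
  shows "C k l I J = 0"
proof -
  note in1 = decomposition_leg_algebra[OF D1] and in2 = decomposition_leg_algebra[OF D2]
  \<comment> \<open>The coefficient that remains in front of the state \<open>k\<close>,
    \<open>I\<close> of leg 1 once the monomial \<open>T\<close> of leg 2 has been read off.\<close>
  define b where "b T k I = (\<Sum>l<length D2. \<Sum>J | length J = fst (D2 ! l).
      C k l I J * gcoeff (snd (D2 ! l) J) T)" for T k I
  have b: "b T k I = 0" if T: "T \<subseteq> leg_gens 2" and kI: "k < length D1" "length I = fst (D1 ! k)"
    for T k I
  proof (rule decomposition_independent[OF D1 _ _ kI])
    show "(\<Sum>k<length D1. \<Sum>I | length I = fst (D1 ! k). b T k I *\<^sub>G snd (D1 ! k) I) = 0"
      (is "?f = 0")
    proof (rule grassmann_eqI)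
      fix S
      show "gcoeff ?f S = gcoeff 0 S"
      proof (cases "S \<subseteq> leg_gens 1")
        case True
        have "gcoeff ?f S = (\<Sum>k<length D1. \<Sum>I | length I = fst (D1 ! k).
            \<Sum>l<length D2. \<Sum>J | length J = fst (D2 ! l).
            C k l I J * gcoeff (snd (D1 ! k) I * snd (D2 ! l) J) (S \<union> T))"
          unfolding b_def gcoeff_sum gcoeff_gscale sum_distrib_right
          by (intro sum.cong refl)
            (simp add: gcoeff_leg_mult[OF in1 in2 True T] mult_ac)
        also have "\<dots> = (\<Sum>k<length D1. \<Sum>l<length D2. \<Sum>I | length I = fst (D1 ! k).
            \<Sum>J | length J = fst (D2 ! l).
            C k l I J * gcoeff (snd (D1 ! k) I * snd (D2 ! l) J) (S \<union> T))"
          by (rule sum.cong[OF refl], rule sum.swap)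
        also have "\<dots> = 0" using arg_cong[OF zero, of "\<lambda>f. gcoeff f (S \<union> T)"] by simp
        finally show ?thesis by simp
      next
        case False
        then have "gcoeff (snd (D1 ! k) I) S = 0" if "k < length D1" "length I = fst (D1 ! k)" for k I
          using in1[OF that] by (auto simp: leg_algebra_iff)
        then show ?thesis by simp
      qed
    qed
  next
    fix k and I I' :: "2 list" assume kI: "k < length D1" "length I = fst (D1 ! k)" and II': "mset I = mset I'"
    show "b T k I = b T k I'"
      unfolding b_def by (intro sum.cong refl) (simp add: C[OF kI(1) _ kI(2) _ II' refl])
  qed
  show ?thesis
  proof (rule decomposition_independent[OF D2 _ _ lJ])
    show "(\<Sum>l<length D2. \<Sum>J | length J = fst (D2 ! l). C k l I J *\<^sub>G snd (D2 ! l) J) = 0"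
      (is "?f = 0")
    proof (rule grassmann_eqI)
      fix T
      show "gcoeff ?f T = gcoeff 0 T"
      proof (cases "T \<subseteq> leg_gens 2")
        case True
        then show ?thesis using b[OF True kI] by (simp add: b_def)
      next
        case False
        then have "gcoeff (snd (D2 ! k) I) T = 0" if "k < length D2" "length I = fst (D2 ! k)" for k I
          using in2[OF that] by (auto simp: leg_algebra_iff)
        then show ?thesis by simp
      qed
    qed
  next
    fix l and J J' :: "2 list"
    assume "l < length D2" "length J = fst (D2 ! l)" "mset J = mset J'"
    with kI show "C k l I J = C k l I J'" by (intro C refl)
  qed
qed

lemma gsubst_gact_leg:
  assumes "f \<in> leg_algebra i"
  shows "gsubst (gact W) f = little_group i (W i) f"
  unfolding little_group_eq_gact
proof (rule gsubst_cong)
  fix S g assume "gcoeff f S \<noteq> 0" "g \<in> S"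
  then have "g \<in> leg_gens i" using assms by (auto simp: leg_algebra_iff)
  then show "gact W g = gact ((\<lambda>_. mat 1)(i := W i)) g"
    by (auto simp: leg_gens_def gact_def)
qed

text \<open>Applying the transformation to the expansion of the invariant \<open>f\<close> and using
  equivariance on each leg gives a second expansion, with transformed coefficients. Independence,
  applied to the difference, identifies the two. The matrices only need determinant 1, by the
  continuation to \<open>SL(2)\<close>.\<close>

lemma component_amplitudes_invariant:
  assumes D1: "little_group_decomposition 1 D1" and D2: "little_group_decomposition 2 D2"
    and comp: "component_amplitudes D1 D2 f C"
    and W: "det (W 1) = 1" "det (W 2) = 1" and inv: "gsubst (gact W) f = f"
    and k: "k < length D1" "length K = fst (D1 ! k)"
    and l: "l < length D2" "length L = fst (D2 ! l)"
  shows "C k l K L = (\<Sum>I | length I = fst (D1 ! k). \<Sum>J | length J = fst (D2 ! l).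
      C k l I J * (\<Prod>a<fst (D1 ! k). W 1 $ (K ! a) $ (I ! a)) *
        (\<Prod>a<fst (D2 ! l). W 2 $ (L ! a) $ (J ! a)))"
proof -
  let ?n1 = "\<lambda>k. fst (D1 ! k)" and ?n2 = "\<lambda>l. fst (D2 ! l)"
  let ?\<phi> = "\<lambda>k. snd (D1 ! k)" and ?\<psi> = "\<lambda>l. snd (D2 ! l)"
  let ?P1 = "\<lambda>k K I. \<Prod>a<?n1 k. W 1 $ (K ! a) $ (I ! a)"
  let ?P2 = "\<lambda>l L J. \<Prod>a<?n2 l. W 2 $ (L ! a) $ (J ! a)"
  define C' where "C' k l K L = (\<Sum>I | length I = ?n1 k. \<Sum>J | length J = ?n2 l.
      C k l I J * ?P1 k K I * ?P2 l L J)" for k l K L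
  have C: "\<And>k l I I' J J'. mset I = mset I' \<Longrightarrow> mset J = mset J' \<Longrightarrow> C k l I J = C k l I' J'"
    and f: "f = (\<Sum>k<length D1. \<Sum>l<length D2. \<Sum>I | length I = ?n1 k. \<Sum>J | length J = ?n2 l.
              C k l I J *\<^sub>G (?\<phi> k I * ?\<psi> l J))"
    using comp unfolding component_amplitudes_def by blast+
  have summand: "gsubst (gact W) (\<Sum>I | length I = ?n1 k. \<Sum>J | length J = ?n2 l.
        C k l I J *\<^sub>G (?\<phi> k I * ?\<psi> l J)) =
      (\<Sum>K | length K = ?n1 k. \<Sum>L | length L = ?n2 l. C' k l K L *\<^sub>G (?\<phi> k K * ?\<psi> l L))"
    if k: "k < length D1" and l: "l < length D2" for k l
  proof (rule grassmann_eqI)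
    fix S
    let ?g = "\<lambda>K L. gcoeff (?\<phi> k K * ?\<psi> l L) S"
    have "gsubst (gact W) (?\<phi> k I * ?\<psi> l J) = (\<Sum>K | length K = ?n1 k. \<Sum>L | length L = ?n2 l.
        (?P1 k K I * ?P2 l L J) *\<^sub>G (?\<phi> k K * ?\<psi> l L))"
      if "length I = ?n1 k" "length J = ?n2 l" for I J
    proof -
      have "gsubst (gact W) (?\<phi> k I * ?\<psi> l J) =
        (\<Sum>K | length K = ?n1 k. ?P1 k K I *\<^sub>G ?\<phi> k K) * (\<Sum>L | length L = ?n2 l. ?P2 l L J *\<^sub>G ?\<psi> l L)"
        using decomposition_equivariant[OF D1 k W(1)] decomposition_equivariant[OF D2 l W(2)] that
        gsubst_gact_leg[OF decomposition_leg_algebra[OF D1 k], of I W]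
        gsubst_gact_leg[OF decomposition_leg_algebra[OF D2 l], of J W]
        by (simp add: gsubst_gact_mult equivariant_def)
      then show ?thesis by (simp add: sum_product gscale_mult gscale_simps mult.commute)
    qed
    then have "gcoeff (gsubst (gact W) (\<Sum>I | length I = ?n1 k. \<Sum>J | length J = ?n2 l.
        C k l I J *\<^sub>G (?\<phi> k I * ?\<psi> l J))) S =
      (\<Sum>I | length I = ?n1 k. \<Sum>J | length J = ?n2 l. \<Sum>K | length K = ?n1 k. \<Sum>L | length L = ?n2 l.
        C k l I J * ?P1 k K I * ?P2 l L J * ?g K L)"
      by (simp add: gsubst_sum gsubst_scale sum_distrib_left mult_ac)
    also have "\<dots> = (\<Sum>K | length K = ?n1 k. \<Sum>L | length L = ?n2 l.
        \<Sum>I | length I = ?n1 k. \<Sum>J | length J = ?n2 l. C k l I J * ?P1 k K I * ?P2 l L J * ?g K L)"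
      by (rule sum_swap_pairs)
    also have "\<dots> = gcoeff (\<Sum>K | length K = ?n1 k. \<Sum>L | length L = ?n2 l.
        C' k l K L *\<^sub>G (?\<phi> k K * ?\<psi> l L)) S"
      by (simp add: C'_def sum_distrib_right)
    finally show "gcoeff (gsubst (gact W) (\<Sum>I | length I = ?n1 k. \<Sum>J | length J = ?n2 l.
        C k l I J *\<^sub>G (?\<phi> k I * ?\<psi> l J))) S =
      gcoeff (\<Sum>K | length K = ?n1 k. \<Sum>L | length L = ?n2 l. C' k l K L *\<^sub>G (?\<phi> k K * ?\<psi> l L)) S" .
  qed
  have f': "f = (\<Sum>k<length D1. \<Sum>l<length D2. \<Sum>K | length K = ?n1 k. \<Sum>L | length L = ?n2 l.
      C' k l K L *\<^sub>G (?\<phi> k K * ?\<psi> l L))"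
  proof -
    have "f = gsubst (gact W) f" using inv by simp
    also have "\<dots> = (\<Sum>k<length D1. \<Sum>l<length D2. gsubst (gact W)
        (\<Sum>I | length I = ?n1 k. \<Sum>J | length J = ?n2 l. C k l I J *\<^sub>G (?\<phi> k I * ?\<psi> l J)))"
      by (subst f) (simp only: gsubst_sum)
    also have "\<dots> = (\<Sum>k<length D1. \<Sum>l<length D2. \<Sum>K | length K = ?n1 k. \<Sum>L | length L = ?n2 l.
      C' k l K L *\<^sub>G (?\<phi> k K * ?\<psi> l L))"
      by (intro sum.cong[OF refl] summand) auto
    finally show ?thesis .
  qed
  have "C k l K L - C' k l K L = 0"
  proof (rule component_amplitudes_independent[OF D1 D2 _ _ k l, where C = "\<lambda>k l K L. C k l K L - C' k l K L"])
    show "(\<Sum>k<length D1. \<Sum>l<length D2. \<Sum>K | length K = ?n1 k. \<Sum>L | length L = ?n2 l.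
      (C k l K L - C' k l K L) *\<^sub>G (?\<phi> k K * ?\<psi> l L)) = 0"
    proof -
      have "(z - w) *\<^sub>G h = z *\<^sub>G h - w *\<^sub>G h" for z w and h :: superfield
        by (rule grassmann_eqI) (simp add: algebra_simps)
      then show ?thesis using f f' by (simp add: sum_subtractf)
    qed
  next
    fix k l and I I' J J' :: "2 list"
    assume len: "length I = ?n1 k" "length J = ?n2 l" and ms: "mset I = mset I'" "mset J = mset J'"
    \<comment> \<open>The transformed coefficients are again symmetric, shown for one leg at a
      time.\<close>
    have "C' k l I J = (\<Sum>A | length A = ?n1 k. (\<Sum>B | length B = ?n2 l.
        C k l A B * ?P2 l J B) * ?P1 k I A)"
      by (simp add: C'_def sum_distrib_left sum_distrib_right mult_ac)
    also have "\<dots> = (\<Sum>A | length A = ?n1 k. (\<Sum>B | length B = ?n2 l.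
        C k l A B * ?P2 l J B) * ?P1 k I' A)"
    proof (rule transform_symmetric[OF _ ms(1) len(1)])
      fix A A' :: "2 list" assume "mset A = mset A'"
      then show "(\<Sum>B | length B = ?n2 l. C k l A B * ?P2 l J B) =
          (\<Sum>B | length B = ?n2 l. C k l A' B * ?P2 l J B)"
        using C[OF _ refl, of A A' k l] by simp
    qed
    also have "\<dots> = (\<Sum>A | length A = ?n1 k. (\<Sum>B | length B = ?n2 l.
        C k l A B * ?P2 l J' B) * ?P1 k I' A)"
      by (simp only: transform_symmetric[OF C[OF refl] ms(2) len(2), where M = "\<lambda>a b. W 2 $ a $ b"])
    also have "\<dots> = C' k l I' J'"
      by (simp add: C'_def sum_distrib_left sum_distrib_right mult_ac)
    finally show "C k l I J - C' k l I J = C k l I' J' - C' k l I' J'"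
      using C[OF ms] by simp
  qed
  then show ?thesis by (simp add: C'_def)
qed

section \<open>Bihomogeneous forms and their invariance\<close>

definition mv :: "complex ^ 2 ^ 2 \<Rightarrow> (2 \<Rightarrow> complex) \<Rightarrow> 2 \<Rightarrow> complex" where
  "mv M u = (\<lambda>a. \<Sum>b\<in>UNIV. M $ a $ b * u b)"

lemma mv_mult: "mv (M ** N) u = mv M (mv N u)"
proof
  fix a
  have "mv (M ** N) u a = (\<Sum>b\<in>UNIV. \<Sum>c\<in>UNIV. M $ a $ c * N $ c $ b * u b)"
    by (simp add: mv_def matrix_matrix_mult_def sum_distrib_right)
  also have "\<dots> = (\<Sum>c\<in>UNIV. \<Sum>b\<in>UNIV. M $ a $ c * N $ c $ b * u b)" by (rule sum.swap)
  also have "\<dots> = mv M (mv N u) a" by (simp add: mv_def sum_distrib_left mult_ac)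
  finally show "mv (M ** N) u a = mv M (mv N u) a" .
qed

lemma mv_mat_1 [simp]: "mv (mat 1) u = u"
  by (rule ext) (simp add: mv_def mat_def if_distrib if_distribR cong: if_cong)

lemma mv_scale: "mv M (\<lambda>a. t * u a) = (\<lambda>a. t * mv M u a)"
  by (rule ext) (simp add: mv_def sum_distrib_left mult_ac)

lemma vec2_eta: "vec2 (u 1) (u 2) = u"
  using exhaust_2 by (fastforce simp: vec2_def)

lemma mv_mat2: "mv (mat2 a b c d) u = vec2 (a * u 1 + b * u 2) (c * u 1 + d * u 2)"
  by (rule ext) (simp add: mv_def sum_2 mat2_def vec2_def)

text \<open>The matrices move from the coefficients to the arguments. They get transposed because
  the summed list \<open>K\<close> labels their rows.\<close>

lemma bitensor_form_transform:
  assumes C: "\<And>K L. length K = n \<Longrightarrow> length L = n' \<Longrightarrow>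
      C K L = (\<Sum>I | length I = n. \<Sum>J | length J = n'.
        C I J * (\<Prod>k<n. U $ (K ! k) $ (I ! k)) * (\<Prod>k<n'. V $ (L ! k) $ (J ! k)))"
  shows "bitensor_form n n' C (mv (transpose U) u) (mv (transpose V) v) = bitensor_form n n' C u v"
proof -
  let ?P = "\<lambda>K I. \<Prod>k<n. U $ (K ! k) $ (I ! k) * u (K ! k)"
  let ?Q = "\<lambda>L J. \<Prod>k<n'. V $ (L ! k) $ (J ! k) * v (L ! k)"
  have "bitensor_form n n' C u v = (\<Sum>K | length K = n. \<Sum>L | length L = n'.
      \<Sum>I | length I = n. \<Sum>J | length J = n'. C I J * ?P K I * ?Q L J)"
  proof -
    have "bitensor_form n n' C u v = (\<Sum>K | length K = n. \<Sum>L | length L = n'.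
        (\<Sum>I | length I = n. \<Sum>J | length J = n'.
          C I J * (\<Prod>k<n. U $ (K ! k) $ (I ! k)) * (\<Prod>k<n'. V $ (L ! k) $ (J ! k))) *
        (\<Prod>k<n. u (K ! k)) * (\<Prod>k<n'. v (L ! k)))"
      unfolding bitensor_form_def
    proof (intro sum.cong refl)
      fix K L :: "2 list"
      assume "K \<in> {K. length K = n}" "L \<in> {L. length L = n'}"
      then show "C K L * (\<Prod>k<n. u (K ! k)) * (\<Prod>k<n'. v (L ! k)) =
          (\<Sum>I | length I = n. \<Sum>J | length J = n'.
            C I J * (\<Prod>k<n. U $ (K ! k) $ (I ! k)) * (\<Prod>k<n'. V $ (L ! k) $ (J ! k))) *
          (\<Prod>k<n. u (K ! k)) * (\<Prod>k<n'. v (L ! k))"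
        by (subst C) auto
    qed
    then show ?thesis
      by (simp add: prod.distrib sum_distrib_right
          sum_distrib_left mult_ac)
  qed
  also have "\<dots> = (\<Sum>I | length I = n. \<Sum>J | length J = n'.
      \<Sum>K | length K = n. \<Sum>L | length L = n'. C I J * ?P K I * ?Q L J)"
    by (rule sum_swap_pairs)
  also have "\<dots> = (\<Sum>I | length I = n. \<Sum>J | length J = n'. C I J *
      ((\<Sum>K | length K = n. ?P K I) * (\<Sum>L | length L = n'. ?Q L J)))"
    by (simp add: sum_product) (simp add: sum_distrib_left mult.assoc)
  also have "\<dots> = bitensor_form n n' C (mv (transpose U) u) (mv (transpose V) v)"
    unfolding bitensor_form_def
    by (simp add: sum_lists_prod[where g = "\<lambda>k j. U $ j $ (I ! k) * u j" for I]
        sum_lists_prod[where g = "\<lambda>k j. V $ j $ (J ! k) * v j" for J]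
        mv_def transpose_def mult.assoc)
  finally show ?thesis by simp
qed

text \<open>Pairs of vectors with a prescribed non-zero determinant form a single orbit.\<close>

lemma invariant_form_eq_det_power:
  fixes G :: "(2 \<Rightarrow> complex) \<Rightarrow> (2 \<Rightarrow> complex) \<Rightarrow> complex"
  assumes hom1: "\<And>t y z. G (\<lambda>a. t * y a) z = t ^ n * G y z"
    and hom2: "\<And>t y z. G y (\<lambda>a. t * z a) = t ^ n' * G y z"
    and inv: "\<And>g y z. det g = 1 \<Longrightarrow> G (mv g y) (mv g z) = G y z"
  obtains K where "\<And>y z. y 1 * z 2 - y 2 * z 1 \<noteq> 0 \<Longrightarrow> G y z = K * (y 1 * z 2 - y 2 * z 1) ^ n"
    and "n \<noteq> n' \<Longrightarrow> K = 0"
proof -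
  let ?d = "\<lambda>y z. y 1 * z 2 - y 2 * z 1 :: complex"
  define K where "K = G (vec2 1 0) (vec2 0 1)"
  have 1: "G y z = K * ?d y z ^ n" if d: "?d y z \<noteq> 0" for y z
  proof -
    define t where "t = ?d y z"
    \<comment> \<open>The matrix with columns \<open>y / t\<close> and \<open>z\<close> has
      determinant 1 and sends \<open>t\<close> times the first basis vector to \<open>y\<close>, the
      second to \<open>z\<close>.\<close>
    let ?g = "mat2 (y 1 / t) (z 1) (y 2 / t) (z 2)"
    have "det ?g = 1" using d by (simp add: det_mat2 t_def diff_divide_distrib[symmetric] mult.commute)
    moreover have "mv ?g (\<lambda>a. t * vec2 1 0 a) = y" "mv ?g (vec2 0 1) = z"
      using d by (simp_all add: mv_mat2 vec2_eta t_def)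
    ultimately have "G y z = G (\<lambda>a. t * vec2 1 0 a) (vec2 0 1)"
      using inv by metis
    then show ?thesis by (simp add: hom1 K_def t_def)
  qed
  have 2: "G y z = K * ?d y z ^ n'" if d: "?d y z \<noteq> 0" for y z
  proof -
    define t where "t = ?d y z"
    \<comment> \<open>Now the scale sits in the second vector, so the other degree \<open>n'\<close>
      appears with the same constant.\<close>
    let ?g = "mat2 (y 1) (z 1 / t) (y 2) (z 2 / t)"
    have "det ?g = 1" using d by (simp add: det_mat2 t_def diff_divide_distrib[symmetric] mult.commute)
    moreover have "mv ?g (vec2 1 0) = y" "mv ?g (\<lambda>a. t * vec2 0 1 a) = z"
      using d by (simp_all add: mv_mat2 vec2_eta t_def)
    ultimately have "G y z = G (vec2 1 0) (\<lambda>a. t * vec2 0 1 a)"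
      using inv by metis
    then show ?thesis by (simp add: hom2 K_def t_def)
  qed
  have "K = 0" if "n \<noteq> n'"
  proof -
    \<comment> \<open>The two formulas are compared at a pair of determinant 2, whose powers are
      distinct.\<close>
    have "K * 2 ^ n = K * 2 ^ n'" using 1[of "vec2 1 0" "vec2 0 2"] 2[of "vec2 1 0" "vec2 0 2"] by auto
    moreover have "(2 :: complex) ^ n \<noteq> 2 ^ n'"
      using that power_inject_exp[of "2::nat" n n'] of_nat_eq_iff[of "2 ^ n" "2 ^ n'", where 'a = complex]
      by simp
    ultimately show ?thesis by (metis mult_cancel_left)
  qed
  then show ?thesis using that 1 by blast
qed

text \<open>In the variables \<open>y = L 1 u\<close> and \<open>z = L 2 v\<close> the form of a
  component is invariant under one matrix \<open>g\<close> acting on both, hence a multiple of a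
  power of their determinant. Up to the factor \<open>\<beta>\<close>, this determinant is the
  contraction of \<open>B\<close> with \<open>u\<close> and \<open>v\<close>. Agreement at
  non-degenerate pairs is enough to identify symmetric tensors.\<close>

lemma minimally_coupledI:
  fixes L N :: "2 \<Rightarrow> complex ^ 2 ^ 2"
  assumes NL: "\<And>i. L i ** N i = mat 1" "\<And>i. N i ** L i = mat 1"
    and inv: "\<And>g. det g = 1 \<Longrightarrow>
      gsubst (gact (\<lambda>i. transpose (N i ** g ** L i))) f = f"
    and B: "\<And>I J. B I J = \<beta> * (L 1 $ 1 $ I * L 2 $ 2 $ J - L 1 $ 2 $ I * L 2 $ 1 $ J)"
    and \<beta>: "\<beta> \<noteq> 0" and y: "y \<noteq> 0"
  shows "minimally_coupled f y B"
  unfolding minimally_coupled_def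
proof (intro allI impI)
  fix D1 D2 C k l
  assume D1: "little_group_decomposition 1 D1" and D2: "little_group_decomposition 2 D2"
    and comp: "component_amplitudes D1 D2 f C" and k: "k < length D1" and l: "l < length D2"
  define n n' where "n = fst (D1 ! k)" and "n' = fst (D2 ! l)"
  let ?F = "bitensor_form n n' (C k l)"
  let ?d = "\<lambda>y z. y 1 * z 2 - y 2 * z 1 :: complex"
  have det_NL: "det (N i) * det (L i) = 1" for i
    using NL(2)[of i] by (metis det_I det_mul)
  then have L: "det (L i) \<noteq> 0" for i by (metis mult_zero_right zero_neq_one)
  have mv_NL: "mv (L i) (mv (N i) u) = u" "mv (N i) (mv (L i) u) = u" for i u
    by (simp_all add: NL flip: mv_mult)
  have C: "\<And>I I' J J'. mset I = mset I' \<Longrightarrow> mset J = mset J' \<Longrightarrow> C k l I J = C k l I' J'"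
    using comp unfolding component_amplitudes_def by blast
  \<comment> \<open>The transposition in \<open>?W\<close> is undone when the matrices pass to the
    arguments of the form.\<close>
  have F_inv: "?F (mv (N 1 ** g ** L 1) u) (mv (N 2 ** g ** L 2) v) = ?F u v" if g: "det g = 1" for g u v
  proof -
    let ?W = "\<lambda>i. transpose (N i ** g ** L i)"
    have detW: "det (?W i) = 1" for i
      using g det_NL[of i] by (simp add: det_mul det_transpose)
    show ?thesis
      using bitensor_form_transform[of n n' "C k l" "?W 1" "?W 2" u v]
        component_amplitudes_invariant[OF D1 D2 comp detW detW inv[OF g] k _ l]
      by (simp add: n_def n'_def)
  qed
  obtain K where K: "\<And>y z. ?d y z \<noteq> 0 \<Longrightarrow> ?F (mv (N 1) y) (mv (N 2) z) = K * ?d y z ^ n"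
    and K0: "n \<noteq> n' \<Longrightarrow> K = 0"
  proof (rule invariant_form_eq_det_power[where G = "\<lambda>y z. ?F (mv (N 1) y) (mv (N 2) z)" and n = n and n' = n'])
    fix g :: "complex ^ 2 ^ 2" and y z :: "2 \<Rightarrow> complex"
    assume "det g = 1"
    from F_inv[OF this, of "mv (N 1) y" "mv (N 2) z"]
    show "?F (mv (N 1) (mv g y)) (mv (N 2) (mv g z)) = ?F (mv (N 1) y) (mv (N 2) z)"
      by (simp add: mv_mult mv_NL)
  qed (use that in \<open>simp_all add: mv_scale bitensor_form_scale\<close>)
  have F: "?F u v = K * ?d (mv (L 1) u) (mv (L 2) v) ^ n" if "?d (mv (L 1) u) (mv (L 2) v) \<noteq> 0" for u v
    using K[OF that] by (simp add: mv_NL)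
  have generic: "infinite {y. ?d (mv (L 1) (vec2 1 z)) (mv (L 2) (vec2 1 y)) \<noteq> 0}" for z
  proof -
    define p q where "p = mv (L 1) (vec2 1 z) 1" and "q = mv (L 1) (vec2 1 z) 2"
    \<comment> \<open>For fixed \<open>z\<close> the determinant is the affine function
      \<open>a + b * y\<close>. If both coefficients vanished, invertibility of \<open>L 2\<close>
      would make \<open>L 1\<close> annihilate \<open>vec2 1 z\<close>, contrary to its own
      invertibility.\<close>
    define a b where "a = p * L 2 $ 2 $ 1 - q * L 2 $ 1 $ 1" and "b = p * L 2 $ 2 $ 2 - q * L 2 $ 1 $ 2"
    have "\<not> (a = 0 \<and> b = 0)"
    proof
      assume "a = 0 \<and> b = 0"
      moreover have "a * L 2 $ 1 $ 2 - b * L 2 $ 1 $ 1 = - p * det (L 2)"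
        "a * L 2 $ 2 $ 2 - b * L 2 $ 2 $ 1 = - q * det (L 2)"
        by (simp_all add: a_def b_def det_2 algebra_simps)
      ultimately have "p = 0" "q = 0" using L[of 2] by auto
      then have "mv (L 1) (vec2 1 z) a = 0" for a using exhaust_2[of a] by (auto simp: p_def q_def)
      then have "mv (L 1) (vec2 1 z) = (\<lambda>_. 0)" by blast
      then have "mv (N 1) (mv (L 1) (vec2 1 z)) 1 = 0" by (simp add: mv_def)
      then show False by (simp add: mv_NL)
    qed
    then have "finite {y. a + b * y = 0}"
    proof (cases "b = 0")
      case False
      have "{y. a + b * y = 0} \<subseteq> {- a / b}"
      proof
        fix y assume "y \<in> {y. a + b * y = 0}"
        then have "b * y = - a" by (simp add: eq_neg_iff_add_eq_0 add.commute)
        with False have "y = - a / b" by (metis nonzero_mult_div_cancel_left)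
        then show "y \<in> {- a / b}" by simp
      qed
      then show ?thesis by (rule finite_subset) simp
    qed simp
    then have "infinite (UNIV - {y. a + b * y = 0})"
      using infinite_UNIV_char_0 by (rule Diff_infinite_finite)
    moreover have "?d (mv (L 1) (vec2 1 z)) (mv (L 2) (vec2 1 y)) = a + b * y" for y
      unfolding p_def[symmetric] q_def[symmetric]
      by (simp add: a_def b_def mv_def[of "L 2"] sum_2 algebra_simps)
    ultimately show ?thesis by (simp add: set_diff_eq)
  qed
  have zero_of_generic: "C' I J = 0"
    if C': "\<And>I I' J J'. mset I = mset I' \<Longrightarrow> mset J = mset J' \<Longrightarrow> C' I J = C' I' J'"
      and gen: "\<And>u v. ?d (mv (L 1) u) (mv (L 2) v) \<noteq> 0 \<Longrightarrow> bitensor_form n n' C' u v = 0"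
      and len: "length I = n" "length J = n'" for C' I J
  proof (rule bitensor_form_eq_0[OF C' _ len])
    show "infinite {y. bitensor_form n n' C' (vec2 1 z) (vec2 1 y) = 0}" for z
      using generic[of z] by (rule infinite_super[rotated]) (auto intro: gen)
  qed
  show "(fst (D1 ! k) \<noteq> fst (D2 ! l) \<longrightarrow>
              (\<forall>I J. length I = fst (D1 ! k) \<longrightarrow> length J = fst (D2 ! l) \<longrightarrow> C k l I J = 0)) \<and>
           (fst (D1 ! k) = fst (D2 ! l) \<longrightarrow>
              (\<exists>K. \<forall>I J. length I = fst (D1 ! k) \<longrightarrow> length J = fst (D2 ! l) \<longrightarrow>
                 C k l I J = K * (y * sym_power B (fst (D1 ! k)) I J)))"
    unfolding n_def[symmetric] n'_def[symmetric]
  proof (intro conjI impI allI exI)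
    fix I J :: "2 list" assume nn': "n \<noteq> n'" and IJ: "length I = n" "length J = n'"
    show "C k l I J = 0"
    proof (rule zero_of_generic[OF _ _ IJ])
      show "C k l I J = C k l I' J'" if "mset I = mset I'" "mset J = mset J'" for I I' J J'
        using C[OF that] .
      show "?F u v = 0" if "?d (mv (L 1) u) (mv (L 2) v) \<noteq> 0" for u v
        using F[OF that] K0[OF nn'] by simp
    qed
  next
    fix I J :: "2 list"
    assume nn': "n = n'" and I: "length I = n" and J: "length J = n'"
    \<comment> \<open>The contraction of \<open>B\<close> is \<open>\<beta>\<close> times the
      determinant, so its power carries \<open>\<beta> ^ n\<close>.\<close>
    define K' where "K' = K / \<beta> ^ n"
    \<comment> \<open>\<open>sym_power\<close> reads entries by position and is controlled only on
      lists of length \<open>n\<close>; the cutoff makes the difference symmetric on all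
      lists.\<close>
    define C' where "C' I J = C k l I J - (if length I = n \<and> length J = n then K' * sym_power B n I J else 0)" for I J
    have "C' I J = 0"
    proof (rule zero_of_generic[OF _ _ I J])
      show "C' I J = C' I' J'" if "mset I = mset I'" "mset J = mset J'" for I I' J J'
        using C[OF that] sym_power_cong[OF that, of n B] that[THEN mset_eq_length] by (auto simp: C'_def)
      fix u v assume d: "?d (mv (L 1) u) (mv (L 2) v) \<noteq> 0"
      have "(\<Sum>i\<in>UNIV. \<Sum>j\<in>UNIV. B i j * u i * v j) = \<beta> * ?d (mv (L 1) u) (mv (L 2) v)"
        by (simp add: B mv_def sum_2 algebra_simps)
      then have "bitensor_form n n (sym_power B n) u v = (\<beta> * ?d (mv (L 1) u) (mv (L 2) v)) ^ n"
        by (simp only: bitensor_form_sym_power)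
      moreover have "bitensor_form n n' C' u v = ?F u v - K' * bitensor_form n n (sym_power B n) u v"
        unfolding bitensor_form_def nn'[symmetric]
        by (simp add: C'_def sum_distrib_left sum_subtractf left_diff_distrib right_diff_distrib
            mult_ac)
      ultimately show "bitensor_form n n' C' u v = 0"
        using F[OF d] \<beta> by (simp add: K'_def power_mult_distrib)
    qed
    then show "C k l I J = (K / \<beta> ^ n / y) * (y * sym_power B n I J)"
      using y I J nn' by (simp add: C'_def K'_def)
  qed
qed

section \<open>Products of spinor-valued supercharges\<close>

definition theta :: "(2 \<Rightarrow> complex ^ 2 ^ 2) \<Rightarrow> 2 \<Rightarrow> 4 \<Rightarrow> superfield" where
  "theta L \<alpha> A = (\<Sum>i\<in>UNIV. \<Sum>I\<in>UNIV. (L i $ \<alpha> $ I) *\<^sub>G eta (Eta i I A))"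

lemma theta_in_span: "theta L \<alpha> A \<in> generator_span"
  unfolding theta_def by (intro generator_span_sum generator_span_closed eta_in_span)

lemma theta_combination:
  "(\<Sum>i\<in>UNIV. \<Sum>I\<in>UNIV. (p * L i $ 1 $ I + q * L i $ 2 $ I) *\<^sub>G eta (Eta i I A)) =
   p *\<^sub>G theta L 1 A + q *\<^sub>G theta L 2 A"
  unfolding theta_def by (simp add: gscale_simps gscale_sum sum.distrib)

text \<open>The product of two anticommuting elements changes by the determinant of a change of
  basis of their span.\<close>

lemma mult_combinations:
  assumes a: "a \<in> generator_span" and b: "b \<in> generator_span"
  shows "(p *\<^sub>G a + q *\<^sub>G b) * (r *\<^sub>G a + s *\<^sub>G b) = (p * s - q * r) *\<^sub>G (a * b)"
proof -
  have "a * a = 0" "b * b = 0"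
    using a b by (auto intro!: anticommute_square generator_span_anticommute)
  moreover have "b * a = - (a * b)" by (rule generator_span_anticommute[OF b a])
  ultimately show ?thesis
    by (simp add: distrib_left distrib_right gscale_mult gscale_simps)
      (rule grassmann_eqI, simp add: algebra_simps)
qed

text \<open>Since \<open>L i ** (N i ** g ** L i) = g ** L i\<close>, these little group
  transformations amount to the same matrix \<open>g\<close> on the spinor index for both
  legs.\<close>

lemma gsubst_theta:
  assumes NL: "\<And>i. L i ** N i = mat 1"
  shows "gsubst (gact (\<lambda>i. transpose (N i ** g ** L i))) (theta L \<alpha> A) =
    g $ \<alpha> $ 1 *\<^sub>G theta L 1 A + g $ \<alpha> $ 2 *\<^sub>G theta L 2 A"
proof -
  have LNg: "L i ** (N i ** g ** L i) = g ** L i" for i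
    by (simp add: matrix_mul_assoc NL)
  have leg: "(\<Sum>I\<in>UNIV. (L i $ \<alpha> $ I) *\<^sub>G gsubst (gact (\<lambda>i. transpose (N i ** g ** L i))) (eta (Eta i I A)))
      = (\<Sum>J\<in>UNIV. ((g ** L i) $ \<alpha> $ J) *\<^sub>G eta (Eta i J A))" for i
  proof -
    have "(\<Sum>I\<in>UNIV. (L i $ \<alpha> $ I) *\<^sub>G gsubst (gact (\<lambda>i. transpose (N i ** g ** L i))) (eta (Eta i I A)))
      = (\<Sum>I\<in>UNIV. \<Sum>J\<in>UNIV. (L i $ \<alpha> $ I * (N i ** g ** L i) $ I $ J) *\<^sub>G eta (Eta i J A))"
      by (simp add: gsubst_eta gact_def gscale_sum gscale_simps transpose_def)
    also have "\<dots> = (\<Sum>J\<in>UNIV. \<Sum>I\<in>UNIV. (L i $ \<alpha> $ I * (N i ** g ** L i) $ I $ J) *\<^sub>G eta (Eta i J A))"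
      by (rule sum.swap)
    also have "\<dots> = (\<Sum>J\<in>UNIV. ((L i ** (N i ** g ** L i)) $ \<alpha> $ J) *\<^sub>G eta (Eta i J A))"
      by (simp add: gscale_sum_left matrix_matrix_mult_def[of "L i"])
    finally show ?thesis by (simp only: LNg)
  qed
  have "gsubst (gact (\<lambda>i. transpose (N i ** g ** L i))) (theta L \<alpha> A) =
      (\<Sum>i\<in>UNIV. \<Sum>J\<in>UNIV. ((g ** L i) $ \<alpha> $ J) *\<^sub>G eta (Eta i J A))"
    unfolding theta_def by (simp only: gsubst_sum gsubst_scale leg)
  also have "\<dots> = g $ \<alpha> $ 1 *\<^sub>G theta L 1 A + g $ \<alpha> $ 2 *\<^sub>G theta L 2 A"
    unfolding theta_combination[symmetric] by (simp add: matrix_matrix_mult_def sum_2)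
  finally show ?thesis .
qed

text \<open>Each \<open>Q A\<close> is multiplied by \<open>det g = 1\<close>, so \<open>f\<close>
  is invariant under the transformations built from \<open>L\<close> and its inverse.\<close>

lemma theta_product_minimally_coupled:
  fixes L :: "2 \<Rightarrow> complex ^ 2 ^ 2"
  defines "Q \<equiv> \<lambda>A. theta L 1 A * theta L 2 A"
  assumes L: "\<And>i. det (L i) \<noteq> 0"
    and f: "f = z *\<^sub>G (Q 1 * Q 2 * (Q 3 * Q 4))"
    and B: "\<And>I J. B I J = \<beta> * (L 1 $ 1 $ I * L 2 $ 2 $ J - L 1 $ 2 $ I * L 2 $ 1 $ J)"
    and \<beta>: "\<beta> \<noteq> 0" and y: "y \<noteq> 0"
  shows "minimally_coupled f y B"
proof -
  have "\<exists>N. L i ** N = mat 1 \<and> N ** L i = mat 1" for i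
    using L[of i] by (simp add: invertible_det_nz[symmetric] invertible_def)
  then obtain N where NL: "\<And>i. L i ** N i = mat 1" "\<And>i. N i ** L i = mat 1"
    by metis
  show ?thesis
  proof (rule minimally_coupledI[OF NL _ B \<beta> y])
    fix g :: "complex ^ 2 ^ 2" assume g: "det g = 1"
    let ?\<rho> = "gsubst (gact (\<lambda>i. transpose (N i ** g ** L i)))"
    have "?\<rho> (Q A) = Q A" for A
      using g unfolding Q_def det_2
      by (simp add: gsubst_gact_mult gsubst_theta[OF NL(1)] mult_combinations theta_in_span
          gscale_simps)
    then show "?\<rho> f = f" by (simp add: f gsubst_scale gsubst_gact_mult)
  qed
qed


section \<open>Projecting out the massless leg\<close>

text \<open>\<open>G\<close> is kept general: \<open>range EtaP\<close> serves to identify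
  expressions in the massive generators alone, a singleton to discard terms lacking one factor of
  the top monomial.\<close>

definition avoids :: "gen set \<Rightarrow> superfield \<Rightarrow> bool" where
  "avoids G f \<longleftrightarrow> (\<forall>S. gcoeff f S \<noteq> 0 \<longrightarrow> S \<inter> G = {})"

lemma avoids_closed:
  "avoids G f \<Longrightarrow> avoids G g \<Longrightarrow> avoids G (f + g)"
  "avoids G f \<Longrightarrow> avoids G g \<Longrightarrow> avoids G (f - g)"
  "avoids G f \<Longrightarrow> avoids G (- f)"
  "avoids G f \<Longrightarrow> avoids G (z *\<^sub>G f)"
  "h \<notin> G \<Longrightarrow> avoids G (eta h)"
  "avoids G 0"
  unfolding avoids_def by (force, force, force, force, auto simp: eta_def split: if_splits)

lemma avoids_mult:
  assumes "avoids G f" "avoids G g"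
  shows "avoids G (f * g)"
  unfolding avoids_def
proof (intro allI impI)
  fix S assume "gcoeff (f * g) S \<noteq> 0"
  then obtain T where "T \<in> Pow S" "gsign T (S - T) * gcoeff f T * gcoeff g (S - T) \<noteq> 0"
    unfolding gcoeff_times by (rule sum.not_neutral_contains_not_neutral)
  then have "T \<inter> G = {}" "(S - T) \<inter> G = {}" using assms unfolding avoids_def by auto
  then show "S \<inter> G = {}" by blast
qed

lemma avoids_sum: "(\<And>i. i \<in> A \<Longrightarrow> avoids G (f i)) \<Longrightarrow> avoids G (\<Sum>i\<in>A. f i)"
  by (induction A rule: infinite_finite_induct) (simp_all add: avoids_closed)

lemma avoids_mono: "avoids G f \<Longrightarrow> G' \<subseteq> G \<Longrightarrow> avoids G' f"
  unfolding avoids_def by blast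

section \<open>Setting the massless generators to zero\<close>

lemma gcoeff_etaP_free_part:
  "gcoeff (etaP_free_part f) S = (if S \<inter> range EtaP = {} then gcoeff f S else 0)"
  by (simp add: etaP_free_part_def)

text \<open>A splitting of a set free of massless generators has two free parts, and a splitting of
  any other set has a part that is not free.\<close>

lemma etaP_free_part_mult: "etaP_free_part (f * g) = etaP_free_part f * etaP_free_part g"
proof (rule grassmann_eqI)
  fix S
  show "gcoeff (etaP_free_part (f * g)) S = gcoeff (etaP_free_part f * etaP_free_part g) S"
  proof (cases "S \<inter> range EtaP = {}")
    case True
    have "gcoeff (etaP_free_part f) T = gcoeff f T"
      "gcoeff (etaP_free_part g) (S - T) = gcoeff g (S - T)" if "T \<in> Pow S" for T
    proof -
      have "T \<inter> range EtaP = {}" "(S - T) \<inter> range EtaP = {}" using True that by blast+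
      then show "gcoeff (etaP_free_part f) T = gcoeff f T"
        "gcoeff (etaP_free_part g) (S - T) = gcoeff g (S - T)"
        by (simp_all only: gcoeff_etaP_free_part if_True simp_thms)
    qed
    then show ?thesis using True by (simp add: gcoeff_etaP_free_part[of "f * g"] gcoeff_times)
  next
    case False
    have "gcoeff (etaP_free_part f * etaP_free_part g) S = 0"
      unfolding gcoeff_times
    proof (rule sum.neutral, rule ballI)
      fix T
      have "T \<inter> range EtaP \<noteq> {} \<or> (S - T) \<inter> range EtaP \<noteq> {}" using False by blast
      then have "gcoeff (etaP_free_part f) T = 0 \<or> gcoeff (etaP_free_part g) (S - T) = 0"
        by (simp only: gcoeff_etaP_free_part if_False simp_thms) metis
      then show "gsign T (S - T) * gcoeff (etaP_free_part f) T * gcoeff (etaP_free_part g) (S - T) = 0"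
        by auto
    qed
    then show ?thesis using False by (simp add: gcoeff_etaP_free_part[of "f * g"])
  qed
qed

lemma etaP_free_part_simps:
  "etaP_free_part (f + g) = etaP_free_part f + etaP_free_part g"
  "etaP_free_part (f - g) = etaP_free_part f - etaP_free_part g"
  "etaP_free_part (z *\<^sub>G f) = z *\<^sub>G etaP_free_part f"
  "etaP_free_part (eta (EtaP A)) = 0"
  by (rule grassmann_eqI; simp add: gcoeff_etaP_free_part; auto simp: eta_def)+

lemma etaP_free_part_avoids: "avoids (range EtaP) f \<Longrightarrow> etaP_free_part f = f"
  by (rule grassmann_eqI) (auto simp: avoids_def gcoeff_etaP_free_part)

text \<open>Only the term \<open>- d H\<close> of each factor survives, and the two signs
  cancel.\<close>

lemma etaP_free_part_S1:
  assumes "\<And>A. avoids (range EtaP) (d A)" "\<And>A. avoids (range EtaP) (H A)"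
  shows "etaP_free_part (S1 \<theta> d H Hb a b) = d a * H a * (d b * H b)"
  using assms by (simp add: S1_def Let_def etaP_free_part_simps etaP_free_part_mult
      etaP_free_part_avoids gscale_simps)

section \<open>The coefficient of the top massless monomial\<close>

lemma gcoeff_etaP_top_coeff:
  "gcoeff (etaP_top_coeff f) S = (if S \<inter> range EtaP = {} then gcoeff f (S \<union> range EtaP) else 0)"
  by (simp add: etaP_top_coeff_def)

lemma etaP_top_coeff_add: "etaP_top_coeff (f + g) = etaP_top_coeff f + etaP_top_coeff g"
  by (rule grassmann_eqI) (simp add: gcoeff_etaP_top_coeff)

lemma etaP_top_coeff_scale: "etaP_top_coeff (z *\<^sub>G f) = z *\<^sub>G etaP_top_coeff f"
  by (rule grassmann_eqI) (simp add: gcoeff_etaP_top_coeff)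

lemma etaP_top_coeff_avoids: "avoids {EtaP A} f \<Longrightarrow> etaP_top_coeff f = 0"
  by (rule grassmann_eqI) (auto simp: avoids_def gcoeff_etaP_top_coeff)

lemma sorted_list_of_range_EtaP: "sorted_list_of_set (range EtaP) = [EtaP 1, EtaP 2, EtaP 3, EtaP 4]"
proof -
  have "range EtaP = set [EtaP 1, EtaP 2, EtaP 3, EtaP 4]"
    using exhaust_4 by auto
  moreover have "sorted [EtaP 1, EtaP 2, EtaP 3, EtaP 4]" "distinct [EtaP 1, EtaP 2, EtaP 3, EtaP 4]"
    by (simp_all add: less_eq_gen_def num4_def)
  ultimately show ?thesis by (metis sorted_list_of_set.idem_if_sorted_distinct)
qed

text \<open>The massless generators stand on the right and come last in the order, so no sign
  appears.\<close>

lemma etaP_top_coeff_mult_etaP: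
  assumes w: "avoids (range EtaP) w"
  shows "etaP_top_coeff (w * (eta (EtaP 1) * (eta (EtaP 2) * (eta (EtaP 3) * eta (EtaP 4))))) = w"
proof (rule grassmann_eqI)
  fix S
  let ?P = "range EtaP"
  have mono: "eta (EtaP 1) * (eta (EtaP 2) * (eta (EtaP 3) * eta (EtaP 4))) = gmono ?P"
    by (simp add: gmono_eq_prod_list sorted_list_of_range_EtaP)
  have "gcoeff (w * gmono ?P) (S \<union> ?P) = gcoeff w S" if S: "S \<inter> ?P = {}"
  proof -
    have "\<not> t < s" if st: "s \<in> S" "t \<in> ?P" for s t
    proof -
      obtain B where t: "t = EtaP B" using st by blast
      obtain i I A where s: "s = Eta i I A" using st S by (cases s) auto
      show ?thesis
        using num_less(1)[of i] num_less(1)[of I] num_less(2)[of A] by (simp add: s t less_gen_def)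
    qed
    then have "{(s, t). s \<in> S \<and> t \<in> ?P \<and> t < s} = {}" by blast
    then have sgn: "gsign S ?P = 1" by (simp only: gsign_def inversions_def card.empty power_0)
    have eq: "S \<union> ?P - T = ?P \<longleftrightarrow> T = S" if "T \<in> Pow (S \<union> ?P)" for T using S that by blast
    have SP: "S \<union> ?P - S = ?P" using S by blast
    have "gcoeff (w * gmono ?P) (S \<union> ?P) =
        (\<Sum>T\<in>Pow (S \<union> ?P). if T = S then gcoeff w S else 0)"
      unfolding gcoeff_times gcoeff_gmono by (rule sum.cong[OF refl]) (simp add: eq SP sgn)
    then show ?thesis by simp
  qed
  then show "gcoeff (etaP_top_coeff (w * (eta (EtaP 1) * (eta (EtaP 2) * (eta (EtaP 3) * eta (EtaP 4)))))) S
      = gcoeff w S"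
    using w unfolding mono gcoeff_etaP_top_coeff avoids_def by auto
qed

text \<open>Expanding the factors one after the other, each term except the last lacks one of the
  \<open>\<eta>\<^sub>P\<close>'s.\<close>

lemma etaP_top_coeff_prod:
  fixes X Y :: "4 \<Rightarrow> superfield"
  assumes X: "\<And>A B. avoids {EtaP B} (X A)" and Y: "\<And>A B. A \<noteq> B \<Longrightarrow> avoids {EtaP B} (Y A)"
  shows "etaP_top_coeff ((X 1 + Y 1) * (X 2 + Y 2) * ((X 3 + Y 3) * (X 4 + Y 4))) =
    etaP_top_coeff (Y 1 * Y 2 * (Y 3 * Y 4))"
proof -
  let ?F = "\<lambda>A. X A + Y A"
  have "?F 1 * ?F 2 * (?F 3 * ?F 4) = X 1 * ?F 2 * (?F 3 * ?F 4) + Y 1 * X 2 * (?F 3 * ?F 4) +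
      Y 1 * Y 2 * (X 3 * ?F 4) + Y 1 * Y 2 * (Y 3 * X 4) + Y 1 * Y 2 * (Y 3 * Y 4)"
    by (simp add: algebra_simps)
  moreover have "etaP_top_coeff (X 1 * ?F 2 * (?F 3 * ?F 4)) = 0"
    by (rule etaP_top_coeff_avoids[of 1]) (intro avoids_mult avoids_closed X Y; simp)
  moreover have "etaP_top_coeff (Y 1 * X 2 * (?F 3 * ?F 4)) = 0"
    by (rule etaP_top_coeff_avoids[of 2]) (intro avoids_mult avoids_closed X Y; simp)
  moreover have "etaP_top_coeff (Y 1 * Y 2 * (X 3 * ?F 4)) = 0"
    by (rule etaP_top_coeff_avoids[of 3]) (intro avoids_mult avoids_closed X Y; simp)
  moreover have "etaP_top_coeff (Y 1 * Y 2 * (Y 3 * X 4)) = 0"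
    by (rule etaP_top_coeff_avoids[of 4]) (intro avoids_mult avoids_closed X Y; simp)
  ultimately show ?thesis by (simp add: etaP_top_coeff_add)
qed

text \<open>The factor of flavour \<open>A\<close> contains no massless generator but
  \<open>EtaP A\<close>, and that only in \<open>Y A\<close>, so the top coefficient needs all four
  \<open>Y A\<close>. Writing \<open>Y A\<close> as minus the even element \<open>W A\<close> times
  its generator, the four signs cancel and the generators move freely to the right.\<close>

lemma etaP_top_coeff_S2:
  fixes d H Hb :: "4 \<Rightarrow> superfield"
  assumes av: "\<And>A. avoids (range EtaP) (d A)" "\<And>A. avoids (range EtaP) (H A)"
      "\<And>A. avoids (range EtaP) (Hb A)"
    and sp: "\<And>A. d A \<in> generator_span" "\<And>A. Hb A \<in> generator_span"
  shows "etaP_top_coeff (S2 x \<theta> d H Hb 1 2 * S2 x \<theta>' d H Hb 3 4) =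
    x\<^sup>2 *\<^sub>G (d 1 * Hb 1 * (d 2 * Hb 2) * (d 3 * Hb 3 * (d 4 * Hb 4)))"
proof -
  let ?e = "\<lambda>A. eta (EtaP A)"
  \<comment> \<open>\<open>Hb\<close> with lowered flavour index.\<close>
  define Ks where "Ks A = (if A = 1 then - Hb 2 else if A = 2 then Hb 1 else if A = 3 then - Hb 4 else Hb 3)"
    for A :: 4
  define \<phi> where "\<phi> A = (if A = 1 \<or> A = 2 then \<theta> else \<theta>')" for A :: 4
  define X where "X A = complex_of_real (cos (\<phi> A)) *\<^sub>G (d A * H A * Ks A) +
      complex_of_real (sin (\<phi> A)) *\<^sub>G d A" for A
  define Y where "Y A = d A * ?e A * Ks A" for A
  define W where "W A = d A * Ks A" for A
  have avK: "avoids (range EtaP) (Ks A)" for A unfolding Ks_def by (simp add: av avoids_closed)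
  have spK: "Ks A \<in> generator_span" for A
  proof -
    have "- f \<in> generator_span" if "f \<in> generator_span" for f :: superfield
      using generator_span_closed(2)[OF that, of "-1"] by (simp add: gscale_simps)
    then show ?thesis unfolding Ks_def by (simp add: sp)
  qed
  have avB: "avoids {EtaP B} f" if "avoids (range EtaP) f" for B f
    using that by (rule avoids_mono) simp
  have X: "avoids {EtaP B} (X A)" for A B
    unfolding X_def by (intro avB avoids_closed avoids_mult av avK)
  have Y: "avoids {EtaP B} (Y A)" if "A \<noteq> B" for A B
    unfolding Y_def using that by (intro avoids_mult avB[OF av(1)] avB[OF avK] avoids_closed) simp
  have Y_eq: "Y A = - (W A * ?e A)" for A
    unfolding Y_def W_def using generator_span_anticommute[OF eta_in_span spK, of "EtaP A" A]
    by (simp add: mult.assoc)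
  have eW: "?e A * W B = W B * ?e A" for A B
  proof -
    have "?e A * W B = - (d B * (?e A * Ks B))"
      unfolding W_def using generator_span_anticommute[OF eta_in_span sp(1), of "EtaP A" B]
      by (simp flip: mult.assoc)
    then show ?thesis
      using generator_span_anticommute[OF eta_in_span spK, of "EtaP A" B] by (simp add: W_def mult.assoc)
  qed
  have eW': "?e A * (W B * f) = W B * (?e A * f)" for A B f
    by (simp add: eW flip: mult.assoc)
  \<comment> \<open>Exchanging two odd elements across a third gives one sign. It cancels the sign
    from lowering the flavour index and puts each \<open>Hb\<close> next to the \<open>d\<close> of
    its own flavour.\<close>
  have swap: "a * b * (c * e) = - (a * e * (c * b))"
    if "a \<in> generator_span" "b \<in> generator_span" "c \<in> generator_span" "e \<in> generator_span"
    for a b c e :: superfield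
  proof -
    have "a * b * (c * e) = - (a * (b * e) * c)"
      using generator_span_anticommute[OF that(3,4)] by (simp add: mult.assoc)
    also have "\<dots> = a * e * (b * c)"
      using generator_span_anticommute[OF that(2,4)] by (simp add: mult.assoc)
    also have "\<dots> = - (a * e * (c * b))"
      using generator_span_anticommute[OF that(2,3)] by simp
    finally show ?thesis .
  qed
  have W12: "W 1 * W 2 = d 1 * Hb 1 * (d 2 * Hb 2)"
    using swap[of "d 1" "Hb 2" "d 2" "Hb 1"] sp by (simp add: W_def Ks_def)
  have W34: "W 3 * W 4 = d 3 * Hb 3 * (d 4 * Hb 4)"
    using swap[of "d 3" "Hb 4" "d 4" "Hb 3"] sp by (simp add: W_def Ks_def)
  have "Y 1 * Y 2 * (Y 3 * Y 4) = W 1 * W 2 * (W 3 * W 4) * (?e 1 * (?e 2 * (?e 3 * ?e 4)))"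
    by (simp add: Y_eq mult.assoc eW eW')
  moreover have "avoids (range EtaP) (W 1 * W 2 * (W 3 * W 4))"
    unfolding W_def by (intro avoids_mult av avK)
  ultimately have top: "etaP_top_coeff (Y 1 * Y 2 * (Y 3 * Y 4)) = W 1 * W 2 * (W 3 * W 4)"
    by (simp only: etaP_top_coeff_mult_etaP)
  have F: "S2 x \<theta> d H Hb 1 2 = (- x) *\<^sub>G ((X 1 + Y 1) * (X 2 + Y 2))"
    "S2 x \<theta>' d H Hb 3 4 = (- x) *\<^sub>G ((X 3 + Y 3) * (X 4 + Y 4))"
    unfolding S2_def Let_def X_def Y_def by (simp_all add: Ks_def \<phi>_def add_ac)
  have "S2 x \<theta> d H Hb 1 2 * S2 x \<theta>' d H Hb 3 4 =
      x\<^sup>2 *\<^sub>G ((X 1 + Y 1) * (X 2 + Y 2) * ((X 3 + Y 3) * (X 4 + Y 4)))"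
    unfolding F by (simp only: gscale_mult gscale_simps(8)) (simp add: power2_eq_square)
  moreover have "etaP_top_coeff ((X 1 + Y 1) * (X 2 + Y 2) * ((X 3 + Y 3) * (X 4 + Y 4))) =
      etaP_top_coeff (Y 1 * Y 2 * (Y 3 * Y 4))"
    by (rule etaP_top_coeff_prod) (fact X, rule Y)
  ultimately show ?thesis by (simp only: etaP_top_coeff_scale top W12 W34)
qed


section \<open>Kinematics\<close>

lemma angle_br_eq: "angle_br v w = v $ 2 * w $ 1 - v $ 1 * w $ 2"
  by (simp add: angle_br_def raise_ix_def sum_2 eps_up_def)

lemma square_br_eq: "square_br v w = v $ 1 * w $ 2 - v $ 2 * w $ 1"
  by (simp add: square_br_def raise_ix_def sum_2 eps_up_def)

lemma massive_momentum_nth: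
  "massive_momentum lam lamt i $ a $ b = lam i 2 $ a * lamt i 1 $ b - lam i 1 $ a * lamt i 2 $ b"
  by (simp add: massive_momentum_def sum_2 eps_dn_def)

text \<open>Contracting the hypothesis on \<open>x\<close> with the spinor \<open>lam i I\<close>
  leaves only brackets of the spinors of leg \<open>i\<close>, whose value cancels \<open>m\<close>.
  The leg is arbitrary because leg 2 satisfies the hypothesis with \<open>- x\<close> in place of
  \<open>x\<close>.\<close>

lemma angle_br_of_momentum:
  assumes m: "m \<noteq> 0"
    and lam: "\<And>I J. angle_br (lam i I) (lam i J) = - m * eps_up I J"
    and x: "\<And>a. m * x * lP $ a = (\<Sum>b\<in>UNIV. massive_momentum lam lamt i $ a $ b * raise_ix lPt $ b)"
  shows "x * angle_br lP (lam i I) = square_br (lamt i I) lPt"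
proof -
  have "m * (x * angle_br lP (lam i I)) = m * square_br (lamt i I) lPt"
  proof -
    have l: "lam i 1 $ 2 * lam i 2 $ 1 - lam i 1 $ 1 * lam i 2 $ 2 = - m"
      using lam[of 1 2] by (simp add: angle_br_eq eps_up_def)
    let ?p = "massive_momentum lam lamt i"
    have x': "m * x * lP $ a = ?p $ a $ 1 * lPt $ 2 - ?p $ a $ 2 * lPt $ 1" for a
      using x[of a] by (simp add: sum_2 raise_ix_def eps_up_def)
    have "m * (x * angle_br lP (lam i I)) =
        (m * x * lP $ 2) * lam i I $ 1 - (m * x * lP $ 1) * lam i I $ 2"
      by (simp add: angle_br_eq algebra_simps)
    also have "\<dots> = - (lam i 1 $ 2 * lam i 2 $ 1 - lam i 1 $ 1 * lam i 2 $ 2) * square_br (lamt i I) lPt"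
      unfolding x' massive_momentum_nth square_br_eq
      using exhaust_2[of I] by (auto simp: algebra_simps)
    finally show ?thesis by (simp add: l)
  qed
  then show ?thesis using m by simp
qed

lemma super_in_span:
  "super_delta lam lP A \<in> generator_span" "super_Hbar lamt lPt xi A \<in> generator_span"
  unfolding super_delta_def super_Hbar_def
  by (intro generator_span_sum generator_span_closed eta_in_span)+

lemma super_avoids:
  "avoids (range EtaP) (super_delta lam lP A)"
  "avoids (range EtaP) (super_H lam lP zeta A)"
  "avoids (range EtaP) (super_Hbar lamt lPt xi A)"
  unfolding super_delta_def super_H_def super_Hbar_def
  by (intro avoids_sum avoids_closed; force)+

text \<open>Both factors combine the same two \<open>theta\<close>s, and the determinant of the
  coefficients is \<open>angle_br zeta lP\<close>. It cancels the normalization of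
  \<open>super_H\<close>, so the reference spinor drops out.\<close>

lemma super_delta_H:
  fixes lam :: "2 \<Rightarrow> 2 \<Rightarrow> spinor"
  assumes "angle_br zeta lP \<noteq> 0"
  defines "L \<equiv> \<lambda>i. \<chi> \<alpha> I. lam i I $ \<alpha>"
  shows "super_delta lam lP A * super_H lam lP zeta A = theta L 1 A * theta L 2 A"
proof -
  have comb: "(\<Sum>i\<in>UNIV. \<Sum>I\<in>UNIV. angle_br v (lam i I) *\<^sub>G eta (Eta i I A)) =
      v $ 2 *\<^sub>G theta L 1 A + (- v $ 1) *\<^sub>G theta L 2 A" for v
    unfolding theta_combination[symmetric] by (simp add: L_def angle_br_eq)
  have "(lP $ 2 * - zeta $ 1 - (- lP $ 1) * zeta $ 2) = angle_br zeta lP"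
    by (simp add: angle_br_eq)
  then show ?thesis
    using assms unfolding super_delta_def super_H_def comb gscale_mult
      mult_combinations[OF theta_in_span theta_in_span]
    by (simp add: gscale_simps)
qed

text \<open>The relation \<open>kin\<close> rewrites \<open>super_delta\<close> through the dotted
  spinors, that is, through the \<open>theta\<close>s of \<open>super_Hbar\<close>. The determinant
  of the coefficients is \<open>square_br xi lPt / x\<close>, which leaves the factor
  \<open>1 / x\<close>.\<close>

lemma super_delta_Hbar:
  fixes lam lamt :: "2 \<Rightarrow> 2 \<Rightarrow> spinor"
  assumes x: "x \<noteq> 0" and xi: "square_br xi lPt \<noteq> 0"
    and kin: "\<And>i I. x * angle_br lP (lam i I) = leg_sign i * square_br (lamt i I) lPt"
  defines "L \<equiv> \<lambda>i. \<chi> \<alpha> I. leg_sign i * lamt i I $ \<alpha>"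
  shows "super_delta lam lP A * super_Hbar lamt lPt xi A = (1 / x) *\<^sub>G (theta L 1 A * theta L 2 A)"
proof -
  have "angle_br lP (lam i I) = lPt $ 2 / x * L i $ 1 $ I + (- lPt $ 1 / x) * L i $ 2 $ I" for i I
  proof -
    have "angle_br lP (lam i I) = leg_sign i * square_br (lamt i I) lPt / x"
      using kin[of i I] x by (metis nonzero_mult_div_cancel_left)
    then show ?thesis using x by (simp add: L_def square_br_eq field_simps)
  qed
  then have delta: "super_delta lam lP A = (lPt $ 2 / x) *\<^sub>G theta L 1 A + (- lPt $ 1 / x) *\<^sub>G theta L 2 A"
    unfolding theta_combination[symmetric] super_delta_def by simp
  have Hbar: "(\<Sum>i\<in>UNIV. \<Sum>I\<in>UNIV. (square_br xi (lamt i I) * leg_sign i) *\<^sub>G eta (Eta i I A)) =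
      (- xi $ 2) *\<^sub>G theta L 1 A + xi $ 1 *\<^sub>G theta L 2 A"
    unfolding theta_combination[symmetric] by (simp add: L_def square_br_eq algebra_simps)
  have "lPt $ 2 / x * xi $ 1 - (- lPt $ 1 / x) * (- xi $ 2) = square_br xi lPt / x"
    using x by (simp add: square_br_eq field_simps)
  then show ?thesis
    using xi unfolding super_Hbar_def Hbar delta gscale_mult mult_combinations[OF theta_in_span theta_in_span]
    by (simp add: gscale_simps)
qed

theorem mainTheorem5:
  fixes m Z12 Z34 \<theta>12 \<theta>34 :: real
    and \<kappa> x :: complex
    and lam lamt :: "2 \<Rightarrow> 2 \<Rightarrow> spinor"
    and lP lPt zeta xi :: spinor
  assumes "m > 0"
    and "\<And>i I J. angle_br (lam i I) (lam i J) = - complex_of_real m * eps_up I J"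
    and "\<And>i I J. square_br (lamt i I) (lamt i J) = complex_of_real m * eps_up I J"
    and "lP \<noteq> 0" and "lPt \<noteq> 0"
    and "massive_momentum lam lamt 1 + massive_momentum lam lamt 2 + massless_momentum lP lPt = 0"
    and "x \<noteq> 0"
    and "\<And>a. x * lP $ a =
           1 / complex_of_real m * (\<Sum>b\<in>UNIV. massive_momentum lam lamt 1 $ a $ b * raise_ix lPt $ b)"
    and "angle_br zeta lP \<noteq> 0" and "square_br xi lPt \<noteq> 0"
    and "\<bar>Z12\<bar> < 2 * m" and "\<bar>Z34\<bar> < 2 * m"
    and "\<theta>12 \<in> {-pi/4<..<pi/4}" and "\<theta>34 \<in> {-pi/4<..<pi/4}"
    and "sin (2 * \<theta>12) = Z12 / (2 * m)" and "sin (2 * \<theta>34) = Z34 / (2 * m)"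
  shows "minimally_coupled
           (etaP_free_part (superamp_plus2 \<kappa> m lam lamt lP lPt x zeta xi \<theta>12 \<theta>34))
           (x ^ 2) (\<lambda>I J. angle_br (lam 1 I) (lam 2 J)) \<and>
         minimally_coupled
           (etaP_top_coeff (superamp_zero \<kappa> m lam lamt lP lPt x zeta xi \<theta>12 \<theta>34))
           (x powi (-2)) (\<lambda>I J. square_br (lamt 1 I) (lamt 2 J))"
proof
  note m = assms(1) and angle = assms(2) and square = assms(3) and momentum = assms(6)
    and x0 = assms(7) and x = assms(8) and zeta = assms(9) and xi = assms(10)
  let ?z = "\<kappa> / (2 * complex_of_real m ^ 2)"
  show "minimally_coupled
           (etaP_free_part (superamp_plus2 \<kappa> m lam lamt lP lPt x zeta xi \<theta>12 \<theta>34))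
           (x ^ 2) (\<lambda>I J. angle_br (lam 1 I) (lam 2 J))"
  \<comment> \<open>Here \<open>\<beta> = -1\<close> because the angle bracket is minus the
    determinant of its two arguments.\<close>
  proof (rule theta_product_minimally_coupled[where L = "\<lambda>i. \<chi> \<alpha> I. lam i I $ \<alpha>" and \<beta> = "-1"
        and z = "?z * x ^ 2"])
    show "det ((\<chi> \<alpha> I. lam i I $ \<alpha>) :: complex ^ 2 ^ 2) \<noteq> 0" for i
    proof -
      have "det ((\<chi> \<alpha> I. lam i I $ \<alpha>) :: complex ^ 2 ^ 2) = - angle_br (lam i 1) (lam i 2)"
        by (simp add: det_2 angle_br_eq mult.commute)
      then show ?thesis using m by (simp add: angle eps_up_def)
    qed
    show "etaP_free_part (superamp_plus2 \<kappa> m lam lamt lP lPt x zeta xi \<theta>12 \<theta>34) =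
        (?z * x ^ 2) *\<^sub>G
        (theta (\<lambda>i. \<chi> \<alpha> I. lam i I $ \<alpha>) 1 1 * theta (\<lambda>i. \<chi> \<alpha> I. lam i I $ \<alpha>) 2 1 *
        (theta (\<lambda>i. \<chi> \<alpha> I. lam i I $ \<alpha>) 1 2 * theta (\<lambda>i. \<chi> \<alpha> I. lam i I $ \<alpha>) 2 2) *
        (theta (\<lambda>i. \<chi> \<alpha> I. lam i I $ \<alpha>) 1 3 * theta (\<lambda>i. \<chi> \<alpha> I. lam i I $ \<alpha>) 2 3 *
        (theta (\<lambda>i. \<chi> \<alpha> I. lam i I $ \<alpha>) 1 4 * theta (\<lambda>i. \<chi> \<alpha> I. lam i I $ \<alpha>) 2 4)))"
      by (simp only: superamp_plus2_def Let_def etaP_free_part_simps etaP_free_part_mult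
          etaP_free_part_S1[OF super_avoids(1,2)] super_delta_H[OF zeta])
  qed (use x0 in \<open>simp_all add: angle_br_eq\<close>)
  let ?p = "massive_momentum lam lamt"
  have kin: "x * angle_br lP (lam i I) = leg_sign i * square_br (lamt i I) lPt" for i I
  proof -
    have m0: "complex_of_real m \<noteq> 0" using m by simp
    have x1: "complex_of_real m * x * lP $ a = (\<Sum>b\<in>UNIV. ?p 1 $ a $ b * raise_ix lPt $ b)" for a
      using x[of a] m0 by (simp add: mult.assoc)
    have "?p 1 $ a $ b + ?p 2 $ a $ b + lP $ a * lPt $ b = 0" for a b
      using arg_cong[OF momentum, of "\<lambda>M. M $ a $ b"] by (simp add: massless_momentum_def)
    then have p2: "?p 2 $ a $ b = - ?p 1 $ a $ b - lP $ a * lPt $ b" for a b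
      by (simp add: eq_neg_iff_add_eq_0 algebra_simps)
    \<comment> \<open>Momentum conservation is contracted with \<open>raise_ix lPt\<close>; the
      massless momentum drops out, as the square bracket of \<open>lPt\<close> with itself is
      zero.\<close>
    have x2: "complex_of_real m * (- x) * lP $ a = (\<Sum>b\<in>UNIV. ?p 2 $ a $ b * raise_ix lPt $ b)" for a
      using x1[of a] unfolding p2 by (simp add: sum_2 raise_ix_def eps_up_def algebra_simps)
    show ?thesis
      using angle_br_of_momentum[where i = 1, OF m0 angle x1, of I]
        angle_br_of_momentum[where i = 2, OF m0 angle x2, of I] exhaust_2[of i]
      by (auto simp: leg_sign_def) (metis minus_minus)
  qed
  let ?L = "\<lambda>i. \<chi> \<alpha> I. leg_sign i * lamt i I $ \<alpha>"
  show "minimally_coupled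
           (etaP_top_coeff (superamp_zero \<kappa> m lam lamt lP lPt x zeta xi \<theta>12 \<theta>34))
           (x powi (-2)) (\<lambda>I J. square_br (lamt 1 I) (lamt 2 J))"
  \<comment> \<open>The square bracket is the determinant itself; \<open>\<beta> = -1\<close> now
    comes from \<open>leg_sign 2\<close>. The two factors \<open>S2\<close> give
    \<open>x ^ 2\<close> and the four flavours \<open>(1 / x) ^ 4\<close>.\<close>
  proof (rule theta_product_minimally_coupled[where L = ?L and \<beta> = "-1" and z = "?z * x ^ 2 * (1 / x) ^ 4"])
    show "det ((\<chi> \<alpha> I. leg_sign i * lamt i I $ \<alpha>) :: complex ^ 2 ^ 2) \<noteq> 0" for i
    proof -
      have "det ((\<chi> \<alpha> I. leg_sign i * lamt i I $ \<alpha>) :: complex ^ 2 ^ 2) =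
          square_br (lamt i 1) (lamt i 2)"
        by (simp add: det_2 square_br_eq leg_sign_def mult.commute)
      then show ?thesis using m by (simp add: square eps_up_def)
    qed
    show "etaP_top_coeff (superamp_zero \<kappa> m lam lamt lP lPt x zeta xi \<theta>12 \<theta>34) =
        (?z * x ^ 2 * (1 / x) ^ 4) *\<^sub>G
        (theta ?L 1 1 * theta ?L 2 1 * (theta ?L 1 2 * theta ?L 2 2) *
        (theta ?L 1 3 * theta ?L 2 3 * (theta ?L 1 4 * theta ?L 2 4)))"
      by (simp only: superamp_zero_def Let_def etaP_top_coeff_scale
          etaP_top_coeff_S2[OF super_avoids super_in_span] super_delta_Hbar[OF x0 xi kin]
          gscale_mult gscale_simps(8))
        (simp add: power4_eq_xxxx mult_ac)
  qed (use x0 in \<open>simp_all add: square_br_eq leg_sign_def\<close>)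
qed

end
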